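(* Let $M^{2n+1}$ be a paracontact metric manifold with paracontact metric structure $(\varphi,\xi,\eta,g)$. The following three conditions are equivalent: (i) $\nabla_\xi h=0$; (ii) $\nabla_\xi\tau=0$; (iii) $l\varphi=\varphi l$. Here $h=\frac12\mathcal L_\xi\varphi$, $\tau=\mathcal L_\xi g$ and $lX=R(X,\xi)\xi$.
   Context: An almost paracontact structure on a smooth $(2n+1)$-manifold $M$ is a triple $(\varphi,\xi,\eta)$ of a $(1,1)$-tensor field, a vector field and a 1-form with $\varphi\xi=0$, $\eta\circ\varphi=0$, $\eta(\xi)=1$, $\varphi^2=\mathrm{id}-\eta\otimes\xi$, and such that $\varphi$ induces an almost paracomplex structure on the distribution $\mathbb D=\ker\eta$ (its $\pm1$-eigendistributions in $\mathbb D$ have equal rank $n$). A compatible metric is a pseudo-Riemannian metric $g$ with $g(\varphi X,\varphi Y)=-g(X,Y)+\eta(X)\eta(Y)$; it has signature $(n+1,n)$ and $\eta(X)=g(X,\xi)$. The structure $(\varphi,\xi,\eta,g)$ is a paracontact metric structure, and $M$ a paracontact metric manifold (also called a paracontact pseudo-Riemannian manifold), if in addition $g(X,\varphi Y)=d\eta(X,Y)$, where $d\eta(X,Y)=\frac12\big(X\eta(Y)-Y\eta(X)-\eta([X,Y])\big)$. Notation: $\nabla$ is the Levi-Civita connection of $g$; $R(X,Y)Z=\nabla_X\nabla_YZ-\nabla_Y\nabla_XZ-\nabla_{[X,Y]}Z$; $\mathcal L$ is the Lie derivative. *)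

theory Defs
  imports "HOL-Analysis.Analysis" "HOL-Library.Function_Algebras"
begin

text \<open>
  Function spaces are real vector spaces under the pointwise operations. Tangent vectors are
  functionals on functions and vector fields are families of tangent vectors, so sums, differences,
  real multiples and \<open>dim\<close> below are all those of the library.
\<close>

instantiation "fun" :: (type, real_vector) real_vector
begin

definition scaleR_fun :: "real \<Rightarrow> ('a \<Rightarrow> 'b) \<Rightarrow> 'a \<Rightarrow> 'b"
  where "scaleR_fun r f = (\<lambda>x. r *\<^sub>R f x)"

instance
  by standard (simp_all add: scaleR_fun_def fun_eq_iff scaleR_add_right scaleR_add_left)

end

subsection \<open>Smooth manifolds\<close>

text \<open>\<open>Ck_on k S f\<close> is intended for open sets \<open>S\<close> only.\<close>

primrec Ck_on ::
  "nat \<Rightarrow> 'a::euclidean_space set \<Rightarrow> ('a \<Rightarrow> 'b::real_normed_vector) \<Rightarrow> bool"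
where
  "Ck_on 0 S f \<longleftrightarrow> continuous_on S f"
| "Ck_on (Suc k) S f \<longleftrightarrow>
     (\<forall>x\<in>S. f differentiable (at x)) \<and>
     (\<forall>v. Ck_on k S (\<lambda>x. frechet_derivative f (at x) v))"

definition smooth_on :: "'a::euclidean_space set \<Rightarrow> ('a \<Rightarrow> 'b::real_normed_vector) \<Rightarrow> bool"
  where "smooth_on S f \<longleftrightarrow> (\<forall>k. Ck_on k S f)"

text \<open>
  The manifold is the whole type \<open>'m\<close>. A chart is a pair \<open>(U, c)\<close>; only the values of \<open>c\<close> on
  \<open>U\<close> matter. The Hausdorff property and second countability are sort constraints on \<open>'m\<close>.
\<close>

type_synonym ('m, 'e) atlas = "('m set \<times> ('m \<Rightarrow> 'e)) set"

definition smooth_atlas :: "('m::topological_space, 'e::euclidean_space) atlas \<Rightarrow> bool"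
  where "smooth_atlas A \<longleftrightarrow>
    (\<forall>(U, c)\<in>A. open U \<and> open (c ` U) \<and> homeomorphism U (c ` U) c (inv_into U c)) \<and>
    (\<Union>(U, c)\<in>A. U) = UNIV \<and>
    (\<forall>(U, c)\<in>A. \<forall>(V, d)\<in>A. smooth_on (c ` (U \<inter> V)) (d \<circ> inv_into U c))"

definition smooth_functions :: "('m, 'e::euclidean_space) atlas \<Rightarrow> ('m \<Rightarrow> real) set"
  where "smooth_functions A = {f. \<forall>(U, c)\<in>A. smooth_on (c ` U) (f \<circ> inv_into U c)}"

text \<open>
  Tangent vectors at \<open>p\<close> are the derivations at \<open>p\<close> of the algebra of smooth functions. They are
  required to vanish off that algebra so that equality of tangent vectors is equality of functions.
\<close>

type_synonym 'm tvec = "('m \<Rightarrow> real) \<Rightarrow> real"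

definition tangent_space :: "('m, 'e::euclidean_space) atlas \<Rightarrow> 'm \<Rightarrow> 'm tvec set"
  where "tangent_space A p = {v.
    (\<forall>f. f \<notin> smooth_functions A \<longrightarrow> v f = 0) \<and>
    (\<forall>f\<in>smooth_functions A. \<forall>g\<in>smooth_functions A. v (f + g) = v f + v g) \<and>
    (\<forall>f\<in>smooth_functions A. \<forall>r. v (r *\<^sub>R f) = r * v f) \<and>
    (\<forall>f\<in>smooth_functions A. \<forall>g\<in>smooth_functions A. v (f * g) = v f * g p + f p * v g)}"

type_synonym 'm vfield = "'m \<Rightarrow> 'm tvec"

definition dir_deriv :: "'m vfield \<Rightarrow> ('m \<Rightarrow> real) \<Rightarrow> 'm \<Rightarrow> real"
  where "dir_deriv X f = (\<lambda>p. X p f)"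

definition vector_fields :: "('m, 'e::euclidean_space) atlas \<Rightarrow> 'm vfield set"
  where "vector_fields A = {X. (\<forall>p. X p \<in> tangent_space A p) \<and>
    (\<forall>f\<in>smooth_functions A. dir_deriv X f \<in> smooth_functions A)}"

definition fscale :: "('m \<Rightarrow> real) \<Rightarrow> 'm vfield \<Rightarrow> 'm vfield"
  where "fscale f X = (\<lambda>p. f p *\<^sub>R X p)"

definition lie_bracket :: "'m vfield \<Rightarrow> 'm vfield \<Rightarrow> 'm vfield"
  where "lie_bracket X Y = (\<lambda>p f. X p (dir_deriv Y f) - Y p (dir_deriv X f))"

subsection \<open>Tensor fields\<close>

text \<open>
  Tensor fields are families of (multi)linear maps on the tangent spaces; their values outside the
  tangent spaces are irrelevant. Such a family is smooth iff it maps smooth vector fields to smooth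
  objects.
\<close>

definition linear_on_tangent ::
  "('m, 'e::euclidean_space) atlas \<Rightarrow> 'm \<Rightarrow> ('m tvec \<Rightarrow> 'b::real_vector) \<Rightarrow> bool"
  where "linear_on_tangent A p L \<longleftrightarrow>
    (\<forall>v\<in>tangent_space A p. \<forall>w\<in>tangent_space A p. L (v + w) = L v + L w) \<and>
    (\<forall>v\<in>tangent_space A p. \<forall>r. L (r *\<^sub>R v) = r *\<^sub>R L v)"

definition app1 :: "('m \<Rightarrow> 'm tvec \<Rightarrow> 'b) \<Rightarrow> 'm vfield \<Rightarrow> 'm \<Rightarrow> 'b"
  where "app1 T X = (\<lambda>p. T p (X p))"

definition app2 :: "('m \<Rightarrow> 'm tvec \<Rightarrow> 'm tvec \<Rightarrow> 'b) \<Rightarrow> 'm vfield \<Rightarrow> 'm vfield \<Rightarrow> 'm \<Rightarrow> 'b"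
  where "app2 T X Y = (\<lambda>p. T p (X p) (Y p))"

definition one_form :: "('m, 'e::euclidean_space) atlas \<Rightarrow> ('m \<Rightarrow> 'm tvec \<Rightarrow> real) \<Rightarrow> bool"
  where "one_form A \<eta> \<longleftrightarrow>
    (\<forall>p. linear_on_tangent A p (\<eta> p)) \<and>
    (\<forall>X\<in>vector_fields A. app1 \<eta> X \<in> smooth_functions A)"

definition tensor_field_11 ::
  "('m, 'e::euclidean_space) atlas \<Rightarrow> ('m \<Rightarrow> 'm tvec \<Rightarrow> 'm tvec) \<Rightarrow> bool"
  where "tensor_field_11 A T \<longleftrightarrow>
    (\<forall>p. linear_on_tangent A p (T p) \<and> (\<forall>v\<in>tangent_space A p. T p v \<in> tangent_space A p)) \<and>
    (\<forall>X\<in>vector_fields A. app1 T X \<in> vector_fields A)"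

definition tensor_field_02 ::
  "('m, 'e::euclidean_space) atlas \<Rightarrow> ('m \<Rightarrow> 'm tvec \<Rightarrow> 'm tvec \<Rightarrow> real) \<Rightarrow> bool"
  where "tensor_field_02 A T \<longleftrightarrow>
    (\<forall>p. \<forall>v\<in>tangent_space A p.
      linear_on_tangent A p (\<lambda>w. T p v w) \<and> linear_on_tangent A p (\<lambda>w. T p w v)) \<and>
    (\<forall>X\<in>vector_fields A. \<forall>Y\<in>vector_fields A. app2 T X Y \<in> smooth_functions A)"

text \<open>
  No signature is prescribed. For a metric compatible with an almost paracontact structure it is
  automatically \<open>(n + 1, n)\<close>.
\<close>

definition pseudo_riemannian_metric ::
  "('m, 'e::euclidean_space) atlas \<Rightarrow> ('m \<Rightarrow> 'm tvec \<Rightarrow> 'm tvec \<Rightarrow> real) \<Rightarrow> bool"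
  where "pseudo_riemannian_metric A g \<longleftrightarrow>
    tensor_field_02 A g \<and>
    (\<forall>p. \<forall>v\<in>tangent_space A p. \<forall>w\<in>tangent_space A p. g p v w = g p w v) \<and>
    (\<forall>p. \<forall>v\<in>tangent_space A p. (\<forall>w\<in>tangent_space A p. g p v w = 0) \<longrightarrow> v = 0)"

text \<open>Exterior derivative of a 1-form, in the normalisation with the factor \<open>1/2\<close>.\<close>

definition ext_deriv ::
  "('m \<Rightarrow> 'm tvec \<Rightarrow> real) \<Rightarrow> 'm vfield \<Rightarrow> 'm vfield \<Rightarrow> 'm \<Rightarrow> real"
  where "ext_deriv \<eta> X Y =
    (1/2) *\<^sub>R (dir_deriv X (app1 \<eta> Y) - dir_deriv Y (app1 \<eta> X) - app1 \<eta> (lie_bracket X Y))"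

subsection \<open>Levi-Civita connection, curvature, derivatives of tensor fields\<close>

definition affine_connection ::
  "('m, 'e::euclidean_space) atlas \<Rightarrow> ('m vfield \<Rightarrow> 'm vfield \<Rightarrow> 'm vfield) \<Rightarrow> bool"
  where "affine_connection A D \<longleftrightarrow>
    (\<forall>X\<in>vector_fields A. \<forall>Y\<in>vector_fields A. D X Y \<in> vector_fields A) \<and>
    (\<forall>X\<in>vector_fields A. \<forall>Y\<in>vector_fields A. \<forall>Z\<in>vector_fields A.
      D (X + Y) Z = D X Z + D Y Z \<and> D X (Y + Z) = D X Y + D X Z) \<and>
    (\<forall>f\<in>smooth_functions A. \<forall>X\<in>vector_fields A. \<forall>Y\<in>vector_fields A.
      D (fscale f X) Y = fscale f (D X Y) \<and>
      D X (fscale f Y) = fscale (dir_deriv X f) Y + fscale f (D X Y))"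

definition levi_civita ::
  "('m, 'e::euclidean_space) atlas \<Rightarrow> ('m \<Rightarrow> 'm tvec \<Rightarrow> 'm tvec \<Rightarrow> real)
    \<Rightarrow> ('m vfield \<Rightarrow> 'm vfield \<Rightarrow> 'm vfield) \<Rightarrow> bool"
  where "levi_civita A g D \<longleftrightarrow>
    affine_connection A D \<and>
    (\<forall>X\<in>vector_fields A. \<forall>Y\<in>vector_fields A. D X Y - D Y X = lie_bracket X Y) \<and>
    (\<forall>X\<in>vector_fields A. \<forall>Y\<in>vector_fields A. \<forall>Z\<in>vector_fields A.
      dir_deriv X (app2 g Y Z) = app2 g (D X Y) Z + app2 g Y (D X Z))"

definition curvature ::
  "('m vfield \<Rightarrow> 'm vfield \<Rightarrow> 'm vfield)
    \<Rightarrow> 'm vfield \<Rightarrow> 'm vfield \<Rightarrow> 'm vfield \<Rightarrow> 'm vfield"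
  where "curvature D X Y Z = D X (D Y Z) - D Y (D X Z) - D (lie_bracket X Y) Z"

text \<open>
  In the following four definitions a tensor field is given, and the result returned, as an operator
  on vector fields (such as \<open>app1 \<phi>\<close> or \<open>app2 g\<close>); this extends the derivative from functions and
  vector fields to tensor fields by the Leibniz rule.
\<close>

definition lie_deriv_11 :: "'m vfield \<Rightarrow> ('m vfield \<Rightarrow> 'm vfield) \<Rightarrow> 'm vfield \<Rightarrow> 'm vfield"
  where "lie_deriv_11 Z T X = lie_bracket Z (T X) - T (lie_bracket Z X)"

definition lie_deriv_02 ::
  "'m vfield \<Rightarrow> ('m vfield \<Rightarrow> 'm vfield \<Rightarrow> 'm \<Rightarrow> real) \<Rightarrow> 'm vfield \<Rightarrow> 'm vfield \<Rightarrow> 'm \<Rightarrow> real"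
  where "lie_deriv_02 Z T X Y =
    dir_deriv Z (T X Y) - T (lie_bracket Z X) Y - T X (lie_bracket Z Y)"

definition cov_deriv_11 ::
  "('m vfield \<Rightarrow> 'm vfield \<Rightarrow> 'm vfield)
    \<Rightarrow> 'm vfield \<Rightarrow> ('m vfield \<Rightarrow> 'm vfield) \<Rightarrow> 'm vfield \<Rightarrow> 'm vfield"
  where "cov_deriv_11 D Z T X = D Z (T X) - T (D Z X)"

definition cov_deriv_02 ::
  "('m vfield \<Rightarrow> 'm vfield \<Rightarrow> 'm vfield)
    \<Rightarrow> 'm vfield \<Rightarrow> ('m vfield \<Rightarrow> 'm vfield \<Rightarrow> 'm \<Rightarrow> real) \<Rightarrow> 'm vfield \<Rightarrow> 'm vfield \<Rightarrow> 'm \<Rightarrow> real"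
  where "cov_deriv_02 D Z T X Y = dir_deriv Z (T X Y) - T (D Z X) Y - T X (D Z Y)"

subsection \<open>Paracontact metric structures\<close>

definition contact_distribution ::
  "('m, 'e::euclidean_space) atlas \<Rightarrow> ('m \<Rightarrow> 'm tvec \<Rightarrow> real) \<Rightarrow> 'm \<Rightarrow> 'm tvec set"
  where "contact_distribution A \<eta> p = {v \<in> tangent_space A p. \<eta> p v = 0}"

definition almost_paracontact ::
  "('m, 'e::euclidean_space) atlas \<Rightarrow> nat \<Rightarrow> ('m \<Rightarrow> 'm tvec \<Rightarrow> 'm tvec) \<Rightarrow> 'm vfield
    \<Rightarrow> ('m \<Rightarrow> 'm tvec \<Rightarrow> real) \<Rightarrow> bool"
  where "almost_paracontact A n \<phi> \<xi> \<eta> \<longleftrightarrow>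
    tensor_field_11 A \<phi> \<and> \<xi> \<in> vector_fields A \<and> one_form A \<eta> \<and>
    (\<forall>p. \<phi> p (\<xi> p) = 0 \<and> \<eta> p (\<xi> p) = 1 \<and>
      (\<forall>v\<in>tangent_space A p. \<eta> p (\<phi> p v) = 0 \<and> \<phi> p (\<phi> p v) = v - \<eta> p v *\<^sub>R \<xi> p)) \<and>
    (\<forall>p. dim {v \<in> contact_distribution A \<eta> p. \<phi> p v = v} = n \<and>
         dim {v \<in> contact_distribution A \<eta> p. \<phi> p v = - v} = n)"

definition paracontact_metric ::
  "('m, 'e::euclidean_space) atlas \<Rightarrow> nat \<Rightarrow> ('m \<Rightarrow> 'm tvec \<Rightarrow> 'm tvec) \<Rightarrow> 'm vfield
    \<Rightarrow> ('m \<Rightarrow> 'm tvec \<Rightarrow> real) \<Rightarrow> ('m \<Rightarrow> 'm tvec \<Rightarrow> 'm tvec \<Rightarrow> real) \<Rightarrow> bool"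
  where "paracontact_metric A n \<phi> \<xi> \<eta> g \<longleftrightarrow>
    almost_paracontact A n \<phi> \<xi> \<eta> \<and> pseudo_riemannian_metric A g \<and>
    (\<forall>p. \<forall>v\<in>tangent_space A p. \<forall>w\<in>tangent_space A p.
      g p (\<phi> p v) (\<phi> p w) = - g p v w + \<eta> p v * \<eta> p w) \<and>
    (\<forall>X\<in>vector_fields A. \<forall>Y\<in>vector_fields A. app2 g X (app1 \<phi> Y) = ext_deriv \<eta> X Y)"

definition h_op :: "('m \<Rightarrow> 'm tvec \<Rightarrow> 'm tvec) \<Rightarrow> 'm vfield \<Rightarrow> 'm vfield \<Rightarrow> 'm vfield"
  where "h_op \<phi> \<xi> X = (1/2) *\<^sub>R lie_deriv_11 \<xi> (app1 \<phi>) X"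

definition tau ::
  "('m \<Rightarrow> 'm tvec \<Rightarrow> 'm tvec \<Rightarrow> real) \<Rightarrow> 'm vfield \<Rightarrow> 'm vfield \<Rightarrow> 'm vfield \<Rightarrow> 'm \<Rightarrow> real"
  where "tau g \<xi> = lie_deriv_02 \<xi> (app2 g)"

definition l_op ::
  "('m vfield \<Rightarrow> 'm vfield \<Rightarrow> 'm vfield) \<Rightarrow> 'm vfield \<Rightarrow> 'm vfield \<Rightarrow> 'm vfield"
  where "l_op D \<xi> X = curvature D X \<xi> \<xi>"

end

theory Submission
  imports Defs
begin

text \<open>
  The skew part of \<open>X \<mapsto> \<nabla>\<^sub>X\<xi>\<close> is determined by \<open>d\<eta>\<close>, so \<open>\<nabla>\<xi> = S - \<phi>\<close> with \<open>S\<close> symmetric and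
  \<open>\<tau>(X, Y) = 2 g(SX, Y)\<close>. From \<open>\<L>\<^sub>\<xi>d\<eta> = 0\<close> one gets \<open>\<nabla>\<^sub>\<xi>\<phi> = - (S\<phi> + \<phi>S)\<close>, and differentiating
  \<open>\<phi>\<^sup>2 = id - \<eta> \<otimes> \<xi>\<close> along \<open>\<xi>\<close> then forces \<open>S\<phi> + \<phi>S = 0\<close> and \<open>\<nabla>\<^sub>\<xi>\<phi> = 0\<close>. Hence \<open>h = \<phi>S\<close> and
  \<open>l = - \<nabla>\<^sub>\<xi>S - S\<^sup>2 - \<phi>\<^sup>2\<close>, so that \<open>\<nabla>\<^sub>\<xi>h = \<phi>(\<nabla>\<^sub>\<xi>S)\<close> and \<open>l\<phi> - \<phi>l = 2 \<phi>(\<nabla>\<^sub>\<xi>S)\<close>. As \<open>\<nabla>\<^sub>\<xi>S\<close> takes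
  values in \<open>ker \<eta>\<close>, where \<open>\<phi>\<close> is injective, all three conditions say that \<open>\<nabla>\<^sub>\<xi>S = 0\<close>.

  Tensor identities are tested against global vector fields, whereas the metric is nondegenerate on
  tangent spaces, that is, on derivations at a point. Extending a derivation to a global vector
  field takes a bump function and Hadamard's lemma.
\<close>

subsection \<open>Calculus of \<open>C\<^sup>k\<close> maps\<close>

text \<open>Derivatives at a point of an open set see only the germ there. The induction generalises
  over both functions because it passes to their directional derivatives.\<close>

lemma Ck_on_cong:
  assumes "open S" "\<And>x. x \<in> S \<Longrightarrow> f x = g x" "Ck_on k S f"
  shows "Ck_on k S g"
  using assms(2,3)
proof (induction k arbitrary: f g)
  case 0
  then show ?case by (simp cong: continuous_on_cong)
next
  case (Suc k)
  have d: "f differentiable at x" if "x \<in> S" for x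
    using Suc.prems(2) that by simp
  have "g differentiable at x" if "x \<in> S" for x
    using d[OF that] has_derivative_transform_within_open[OF _ assms(1) that, of f _ UNIV g]
      Suc.prems(1) unfolding differentiable_def by auto
  moreover have "Ck_on k S (\<lambda>x. frechet_derivative g (at x) v)" for v
  proof (rule Suc.IH)
    show "Ck_on k S (\<lambda>x. frechet_derivative f (at x) v)"
      using Suc.prems(2) by simp
    show "frechet_derivative f (at x) v = frechet_derivative g (at x) v" if "x \<in> S" for x
      using frechet_derivative_transform_within_open[OF d[OF that] assms(1) that] Suc.prems(1)
      by metis
  qed
  ultimately show ?case by simp
qed

text \<open>Lets an explicit derivative formula, valid only on \<open>S\<close>, replace the
  choice-based \<open>frechet_derivative\<close>.\<close>

lemma Ck_on_SucI:
  assumes "open S" "\<And>x. x \<in> S \<Longrightarrow> (f has_derivative f' x) (at x)"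
    and "\<And>v. Ck_on k S (\<lambda>x. f' x v)"
  shows "Ck_on (Suc k) S f"
proof -
  have "Ck_on k S (\<lambda>x. frechet_derivative f (at x) v)" for v
    by (rule Ck_on_cong[OF assms(1) _ assms(3)]) (simp add: frechet_derivative_at[OF assms(2), symmetric])
  moreover have "\<forall>x\<in>S. f differentiable at x"
    using differentiableI[OF assms(2)] by blast
  ultimately show ?thesis by simp
qed

lemma Ck_on_has_derivative:
  "Ck_on (Suc k) S f \<Longrightarrow> x \<in> S \<Longrightarrow> (f has_derivative frechet_derivative f (at x)) (at x)"
  by (simp add: frechet_derivative_works[symmetric])

lemma Ck_on_Suc_imp: "Ck_on (Suc k) S f \<Longrightarrow> Ck_on k S f"
proof (induction k arbitrary: f)
  case 0
  then show ?case
    by (simp add: continuous_at_imp_continuous_on differentiable_imp_continuous_within)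
next
  case (Suc k)
  have "Ck_on k S (\<lambda>x. frechet_derivative f (at x) v)" for v
    by (rule Suc.IH) (use Suc.prems in simp)
  then show ?case using Suc.prems by simp
qed

lemma Ck_on_imp_continuous_on: "Ck_on k S f \<Longrightarrow> continuous_on S f"
proof (induction k)
  case (Suc k)
  then show ?case using Ck_on_Suc_imp[OF Suc.prems] by blast
qed simp

lemma Ck_on_subset: "Ck_on k S f \<Longrightarrow> T \<subseteq> S \<Longrightarrow> Ck_on k T f"
  by (induction k arbitrary: f) (auto intro: continuous_on_subset)

text \<open>Derivatives are taken at points, without reference to the set, so only continuity has to
  be glued, and continuity is local on open sets.\<close>

lemma Ck_on_Union:
  "(\<And>T. T \<in> F \<Longrightarrow> open T \<and> Ck_on k T f) \<Longrightarrow> Ck_on k (\<Union>F) f"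
proof (induction k arbitrary: f)
  case 0
  then show ?case by (auto intro: continuous_on_open_Union)
next
  case (Suc k)
  have "Ck_on k (\<Union>F) (\<lambda>x. frechet_derivative f (at x) v)" for v
    by (rule Suc.IH) (use Suc.prems in auto)
  then show ?case using Suc.prems by auto
qed

lemma Ck_on_const: "open S \<Longrightarrow> Ck_on k S (\<lambda>x. c)"
proof (induction k arbitrary: c)
  case (Suc k)
  show ?case
    by (rule Ck_on_SucI[OF Suc.prems has_derivative_const]) (rule Suc.IH[OF Suc.prems])
qed simp

lemma Ck_on_add:
  assumes "open S"
  shows "Ck_on k S f \<Longrightarrow> Ck_on k S g \<Longrightarrow> Ck_on k S (\<lambda>x. f x + g x)"
proof (induction k arbitrary: f g)
  case 0
  then show ?case by (auto intro!: continuous_intros)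
next
  case (Suc k)
  show ?case
    by (rule Ck_on_SucI[OF assms has_derivative_add[OF Ck_on_has_derivative[OF Suc.prems(1)]
            Ck_on_has_derivative[OF Suc.prems(2)]]])
      (use Suc in auto)
qed

lemma Ck_on_sum:
  assumes "open S" "\<And>i. i \<in> I \<Longrightarrow> Ck_on k S (f i)"
  shows "Ck_on k S (\<lambda>x. \<Sum>i\<in>I. f i x)"
  using assms(2)
  by (induction I rule: infinite_finite_induct) (simp_all add: Ck_on_add Ck_on_const assms(1))

lemma Ck_on_bounded_linear:
  assumes "open S" "bounded_linear L"
  shows "Ck_on k S f \<Longrightarrow> Ck_on k S (\<lambda>x. L (f x))"
proof (induction k arbitrary: f)
  case 0
  then show ?case by (auto intro: bounded_linear.continuous_on[OF assms(2)])
next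
  case (Suc k)
  show ?case
    by (rule Ck_on_SucI[OF assms(1) bounded_linear.has_derivative[OF assms(2)
            Ck_on_has_derivative[OF Suc.prems]]])
      (use Suc in auto)
qed

lemma Ck_on_id: "open S \<Longrightarrow> Ck_on k S (\<lambda>x. x)"
proof (cases k)
  case (Suc j)
  assume "open S"
  then show ?thesis
    unfolding Suc by (intro Ck_on_SucI[OF _ has_derivative_ident]) (simp_all add: Ck_on_const)
qed simp

lemma Ck_on_linear: "open S \<Longrightarrow> bounded_linear L \<Longrightarrow> Ck_on k S L"
  using Ck_on_bounded_linear[OF _ _ Ck_on_id] .

text \<open>Each term of the product rule pairs a derivative with an undifferentiated factor, so
  both factors vary in the induction and the undifferentiated one is first lowered to order
  \<open>k\<close>.\<close>

lemma Ck_on_scaleR: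
  fixes f :: "'a::euclidean_space \<Rightarrow> real"
  assumes "open S"
  shows "Ck_on k S f \<Longrightarrow> Ck_on k S g \<Longrightarrow> Ck_on k S (\<lambda>x. f x *\<^sub>R g x)"
proof (induction k arbitrary: f g)
  case 0
  then show ?case by (auto intro: continuous_intros)
next
  case (Suc k)
  have fg: "Ck_on k S f" "Ck_on k S g"
    using Suc.prems[THEN Ck_on_Suc_imp] .
  have Df: "Ck_on k S (\<lambda>x. frechet_derivative f (at x) v)"
    and Dg: "Ck_on k S (\<lambda>x. frechet_derivative g (at x) v)" for v
    using Suc.prems by auto
  show ?case
  proof (rule Ck_on_SucI[OF assms])
    show "((\<lambda>x. f x *\<^sub>R g x) has_derivative (\<lambda>v. f x *\<^sub>R frechet_derivative g (at x) v +
        frechet_derivative f (at x) v *\<^sub>R g x)) (at x)" if "x \<in> S" for x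
      using has_derivative_scaleR[OF Ck_on_has_derivative[OF Suc.prems(1) that]
          Ck_on_has_derivative[OF Suc.prems(2) that]] .
    show "Ck_on k S (\<lambda>x. f x *\<^sub>R frechet_derivative g (at x) v +
        frechet_derivative f (at x) v *\<^sub>R g x)" for v
      by (intro Ck_on_add[OF assms] Suc.IH[OF fg(1) Dg] Suc.IH[OF Df fg(2)])
  qed
qed

lemma Ck_on_mult:
  fixes f g :: "'a::euclidean_space \<Rightarrow> real"
  assumes "open S" "Ck_on k S f" "Ck_on k S g"
  shows "Ck_on k S (\<lambda>x. f x * g x)"
  using Ck_on_scaleR[OF assms] by simp

text \<open>Induction through the chain rule: \<open>f\<close> stays fixed, and the directional
  derivatives of \<open>g\<close> take the place of \<open>g\<close>.\<close>

lemma Ck_on_compose: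
  fixes f :: "'a::euclidean_space \<Rightarrow> 'b::euclidean_space" and g :: "'b \<Rightarrow> 'c::real_normed_vector"
  assumes "open S" "f ` S \<subseteq> T"
  shows "Ck_on k S f \<Longrightarrow> Ck_on k T g \<Longrightarrow> Ck_on k S (\<lambda>x. g (f x))"
proof (induction k arbitrary: g)
  case 0
  then show ?case using assms(2) by (auto intro: continuous_on_compose2)
next
  case (Suc k)
  let ?Df = "\<lambda>x. frechet_derivative f (at x)" and ?Dg = "\<lambda>y. frechet_derivative g (at y)"
  have f: "Ck_on k S f"
    using Ck_on_Suc_imp[OF Suc.prems(1)] .
  have dg: "(g has_derivative ?Dg (f x)) (at (f x))" if "x \<in> S" for x
    using Ck_on_has_derivative[OF Suc.prems(2)] that assms(2) by blast
  \<comment> \<open>The direction \<open>?Df x v\<close> moves with \<open>x\<close>, whereas the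
    induction hypothesis handles fixed directions only; expanding in the basis separates the
    two.\<close>
  have eq: "?Dg (f x) (?Df x v) = (\<Sum>b\<in>Basis. (?Df x v \<bullet> b) *\<^sub>R ?Dg (f x) b)"
    if "x \<in> S" for x v
  proof -
    interpret linear "?Dg (f x)"
      using dg[OF that] has_derivative_linear by blast
    show ?thesis
      by (subst euclidean_representation[of "?Df x v", symmetric]) (simp only: sum scaleR)
  qed
  show ?case
  proof (rule Ck_on_SucI[OF assms(1)])
    show "((\<lambda>x. g (f x)) has_derivative (\<lambda>v. ?Dg (f x) (?Df x v))) (at x)" if "x \<in> S" for x
      using has_derivative_compose[OF Ck_on_has_derivative[OF Suc.prems(1) that] dg[OF that]] .
    have "Ck_on k S (\<lambda>x. \<Sum>b\<in>Basis. (?Df x v \<bullet> b) *\<^sub>R ?Dg (f x) b)" for v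
    proof (intro Ck_on_sum Ck_on_scaleR assms(1))
      show "Ck_on k S (\<lambda>x. ?Df x v \<bullet> b)" for b
        by (rule Ck_on_bounded_linear[OF assms(1) bounded_linear_inner_left])
          (use Suc.prems(1) in simp)
      show "Ck_on k S (\<lambda>x. ?Dg (f x) b)" for b
        by (rule Suc.IH[OF f]) (use Suc.prems in simp)
    qed
    then show "Ck_on k S (\<lambda>x. ?Dg (f x) (?Df x v))" for v
      by (rule Ck_on_cong[OF assms(1) _, rotated]) (simp add: eq)
  qed
qed

lemma smooth_on_Ck: "smooth_on S f \<Longrightarrow> Ck_on k S f"
  by (simp add: smooth_on_def)

lemma smooth_on_subset: "smooth_on S f \<Longrightarrow> T \<subseteq> S \<Longrightarrow> smooth_on T f"
  unfolding smooth_on_def using Ck_on_subset by blast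

lemma smooth_on_cong:
  "open S \<Longrightarrow> (\<And>x. x \<in> S \<Longrightarrow> f x = g x) \<Longrightarrow> smooth_on S f \<Longrightarrow> smooth_on S g"
  unfolding smooth_on_def using Ck_on_cong by blast

lemma smooth_on_Un:
  assumes "open S" "open T" "smooth_on S f" "smooth_on T f"
  shows "smooth_on (S \<union> T) f"
  using Ck_on_Union[of "{S, T}" _ f] assms by (auto simp: smooth_on_def)

lemma smooth_on_const: "open S \<Longrightarrow> smooth_on S (\<lambda>x. c)"
  by (simp add: smooth_on_def Ck_on_const)

lemma smooth_on_add:
  "open S \<Longrightarrow> smooth_on S f \<Longrightarrow> smooth_on S g \<Longrightarrow> smooth_on S (\<lambda>x. f x + g x)"
  by (simp add: smooth_on_def Ck_on_add)

lemma smooth_on_mult: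
  fixes f g :: "'a::euclidean_space \<Rightarrow> real"
  shows "open S \<Longrightarrow> smooth_on S f \<Longrightarrow> smooth_on S g \<Longrightarrow> smooth_on S (\<lambda>x. f x * g x)"
  by (simp add: smooth_on_def Ck_on_mult)

lemma smooth_on_compose:
  fixes f :: "'a::euclidean_space \<Rightarrow> 'b::euclidean_space"
  shows "open S \<Longrightarrow> f ` S \<subseteq> T \<Longrightarrow> smooth_on S f \<Longrightarrow> smooth_on T g \<Longrightarrow>
    smooth_on S (\<lambda>x. g (f x))"
  by (simp add: smooth_on_def Ck_on_compose)

lemma smooth_on_has_derivative:
  "smooth_on S f \<Longrightarrow> x \<in> S \<Longrightarrow> (f has_derivative frechet_derivative f (at x)) (at x)"
  using Ck_on_has_derivative smooth_on_Ck by blast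

lemma smooth_on_frechet_derivative:
  "smooth_on S f \<Longrightarrow> smooth_on S (\<lambda>x. frechet_derivative f (at x) v)"
  unfolding smooth_on_def using Ck_on.simps(2) by blast

subsection \<open>A bump function\<close>

text \<open>The powers of \<open>inverse t\<close> close the family under differentiation up to
  linear combinations, so that smoothness of the flat function \<open>exp_tail 0\<close> can be
  proved for all members at once.\<close>

definition exp_tail :: "nat \<Rightarrow> real \<Rightarrow> real"
  where "exp_tail n t = (if t > 0 then inverse t ^ n * exp (- inverse t) else 0)"

text \<open>With s = 1/t the right-hand limit becomes that of s^n / exp s at infinity.\<close>

lemma exp_tail_tendsto_0: "(exp_tail n \<longlongrightarrow> 0) (at 0)"
proof -
  have "((\<lambda>t. inverse t ^ n / exp (inverse t)) \<longlongrightarrow> (0::real)) (at_right 0)"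
    using filterlim_compose[OF tendsto_power_div_exp_0 filterlim_inverse_at_top_right] .
  then have "(exp_tail n \<longlongrightarrow> 0) (at_right 0)"
    by (rule Lim_transform_eventually)
      (auto simp: eventually_at_right_less exp_tail_def exp_minus field_simps
        intro!: eventually_at_rightI[of 0 1])
  moreover have "(exp_tail n \<longlongrightarrow> 0) (at_left 0)"
    by (rule Lim_transform_eventually[OF tendsto_const])
      (auto simp: exp_tail_def intro!: eventually_at_leftI[of "-1"])
  ultimately show ?thesis using filterlim_split_at by blast
qed

lemma exp_tail_has_derivative:
  "(exp_tail n has_real_derivative exp_tail (n + 2) t - real n * exp_tail (n + 1) t) (at t)"
proof -
  consider "t > 0" | "t < 0" | "t = 0" by linarith
  then show ?thesis
  proof cases
    case 1
    have "((\<lambda>t. inverse t ^ n * exp (- inverse t)) has_real_derivative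
        exp_tail (n + 2) t - real n * exp_tail (n + 1) t) (at t)"
      using 1 by (auto intro!: derivative_eq_intros simp: exp_tail_def power2_eq_square)
        (cases n; simp add: field_simps)
    then show ?thesis
      by (rule has_field_derivative_transform_within_open[of _ _ _ "{0<..}"])
        (use 1 in \<open>auto simp: exp_tail_def\<close>)
  next
    case 2
    have "((\<lambda>t. 0) has_real_derivative exp_tail (n + 2) t - real n * exp_tail (n + 1) t) (at t)"
      using 2 by (simp add: exp_tail_def)
    then show ?thesis
      by (rule has_field_derivative_transform_within_open[of _ _ _ "{..<0}"])
        (use 2 in \<open>auto simp: exp_tail_def\<close>)
  next
    case 3
    \<comment> \<open>At 0 the difference quotient of \<open>exp_tail n\<close> is
      \<open>exp_tail (Suc n)\<close>, which tends to 0.\<close>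
    have "((\<lambda>t. (exp_tail n t - exp_tail n 0) / (t - 0)) \<longlongrightarrow> 0) (at 0)"
      by (rule Lim_transform_eventually[OF exp_tail_tendsto_0[of "Suc n"]])
        (auto simp: exp_tail_def field_simps intro!: always_eventually)
    then show ?thesis
      using 3 by (simp add: has_field_derivative_iff exp_tail_def)
  qed
qed

lemma smooth_on_exp_tail: "smooth_on UNIV (exp_tail n)"
  unfolding smooth_on_def
proof
  show "Ck_on k UNIV (exp_tail n)" for k
  proof (induction k arbitrary: n)
    case 0
    show ?case
      using DERIV_isCont[OF exp_tail_has_derivative] by (simp add: continuous_at_imp_continuous_on)
  next
    case (Suc k)
    show ?case
    proof (rule Ck_on_SucI)
      show "(exp_tail n has_derivative
          (\<lambda>v. (exp_tail (n + 2) t + (- real n) * exp_tail (n + 1) t) * v)) (at t)" for t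
        using exp_tail_has_derivative[of n t] unfolding has_field_derivative_def
        by simp
      show "Ck_on k UNIV (\<lambda>t. (exp_tail (n + 2) t + (- real n) * exp_tail (n + 1) t) * v)" for v
        by (intro Ck_on_add Ck_on_mult Ck_on_const Suc.IH open_UNIV)
    qed simp
  qed
qed

lemma smooth_bump_exists:
  fixes a :: "'a::euclidean_space"
  assumes "r > 0"
  obtains b :: "'a \<Rightarrow> real"
  where "smooth_on UNIV b" "b a = 1" "\<And>x. x \<notin> cball a r \<Longrightarrow> b x = 0"
proof
  \<comment> \<open>This is r^2 - |x - a|^2, written with coordinates so that smoothness follows
    from that of sums and products of affine functions.\<close>
  define q where "q = (\<lambda>x::'a. r\<^sup>2 + (\<Sum>i\<in>Basis. ((x + - a) \<bullet> i) * ((a + - x) \<bullet> i)))"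
  \<comment> \<open>As \<open>q a\<close> is r^2, the constant factor normalises the value at
    \<open>a\<close> to 1.\<close>
  define b where "b = (\<lambda>x. exp (inverse (r\<^sup>2)) * exp_tail 0 (q x))"
  have q: "q x = r\<^sup>2 - (dist a x)\<^sup>2" for x
    unfolding q_def euclidean_inner[symmetric] dist_norm power2_norm_eq_inner
    by (simp add: inner_diff_left inner_diff_right)
  have lin: "Ck_on k UNIV (\<lambda>x::'a. (x + - a) \<bullet> i)" "Ck_on k UNIV (\<lambda>x::'a. (a + - x) \<bullet> i)" for i k
    by (intro Ck_on_bounded_linear[OF _ bounded_linear_inner_left] Ck_on_add Ck_on_const Ck_on_id
        Ck_on_linear[OF _ bounded_linear_minus[OF bounded_linear_ident]] open_UNIV)+
  have "smooth_on UNIV q"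
    unfolding smooth_on_def q_def
    by (intro allI Ck_on_add Ck_on_const Ck_on_sum Ck_on_mult lin open_UNIV)
  then have "smooth_on UNIV (\<lambda>x. exp_tail 0 (q x))"
    by (intro smooth_on_compose[OF _ _ _ smooth_on_exp_tail]) auto
  then show "smooth_on UNIV b"
    unfolding b_def by (intro smooth_on_mult smooth_on_const) auto
  show "b a = 1"
    using assms by (simp add: b_def q exp_tail_def mult_exp_exp)
  show "b x = 0" if "x \<notin> cball a r" for x
  proof -
    have "r\<^sup>2 \<le> (dist a x)\<^sup>2"
      using that assms by (intro power_mono) auto
    then show ?thesis by (simp add: b_def q exp_tail_def)
  qed
qed

subsection \<open>Hadamard's lemma\<close>

text \<open>Differentiation under the integral sign. Each derivative in \<open>x\<close> brings out
  another factor \<open>t\<close>, hence the weight \<open>t ^ j\<close> with \<open>j\<close>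
  arbitrary in the induction.\<close>

lemma Ck_on_integral_segment:
  fixes H :: "'a::euclidean_space \<Rightarrow> real"
  shows "Ck_on k UNIV H \<Longrightarrow>
    Ck_on k UNIV (\<lambda>x. integral {0..1} (\<lambda>t. t ^ j * H (a + t *\<^sub>R (x - a))))"
proof (induction k arbitrary: H j)
  case 0
  have "continuous_on UNIV H" using 0 by simp
  then have "continuous_on (UNIV \<times> cbox 0 1)
      (\<lambda>(x, t). t ^ j * H (a + t *\<^sub>R (x - a)))"
    by (auto simp: case_prod_beta intro!: continuous_intros continuous_on_compose2[of UNIV H])
  from integral_continuous_on_param[OF this] show ?case by simp
next
  case (Suc k)
  let ?DH = "\<lambda>x. frechet_derivative H (at x)"
  \<comment> \<open>The derivative of the integrand in \<open>x\<close>, as a bounded linear map: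
    the Leibniz rule integrates it in the space of such maps.\<close>
  define F where "F = (\<lambda>x t. t ^ Suc j *\<^sub>R Blinfun (?DH (a + t *\<^sub>R (x - a))))"
  have H: "continuous_on UNIV H"
    using Ck_on_imp_continuous_on[OF Suc.prems] .
  have DH: "(H has_derivative ?DH x) (at x)" for x
    using Ck_on_has_derivative[OF Suc.prems] by simp
  have DHc: "continuous_on UNIV (\<lambda>x. ?DH x v)" for v
    using Suc.prems by (intro Ck_on_imp_continuous_on[of k]) simp
  have F: "blinfun_apply (F x t) v = t ^ Suc j * ?DH (a + t *\<^sub>R (x - a)) v" for x t v
    by (simp add: F_def scaleR_blinfun.rep_eq bounded_linear_Blinfun_apply
        has_derivative_bounded_linear[OF DH])
  have contF: "continuous_on (UNIV \<times> cbox 0 1) (\<lambda>(x, t). F x t)"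
    unfolding case_prod_beta
    by (rule continuous_on_blinfun_componentwise)
      (auto simp: F intro!: continuous_intros continuous_on_compose2[OF DHc])
  have deriv: "((\<lambda>x. integral (cbox 0 1) (\<lambda>t. t ^ j * H (a + t *\<^sub>R (x - a))))
      has_derivative integral (cbox 0 1) (F x0)) (at x0 within UNIV)" for x0
  proof (rule leibniz_rule)
    fix x :: 'a and t :: real
    have "((\<lambda>x. a + t *\<^sub>R (x - a)) has_derivative (\<lambda>v. t *\<^sub>R v)) (at x)"
      by (auto intro!: derivative_eq_intros)
    from has_derivative_mult_right[OF has_derivative_compose[OF this DH]]
    have "((\<lambda>x. t ^ j * H (a + t *\<^sub>R (x - a))) has_derivative
        (\<lambda>v. t ^ j * ?DH (a + t *\<^sub>R (x - a)) (t *\<^sub>R v))) (at x)" .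
    moreover have "(\<lambda>v. t ^ j * ?DH (a + t *\<^sub>R (x - a)) (t *\<^sub>R v)) = blinfun_apply (F x t)"
      using linear_scale[OF has_derivative_linear[OF DH]] by (auto simp: F fun_eq_iff)
    ultimately show "((\<lambda>x. t ^ j * H (a + t *\<^sub>R (x - a))) has_derivative blinfun_apply (F x t))
        (at x within UNIV)" by simp
  next
    show "(\<lambda>t. t ^ j * H (a + t *\<^sub>R (x - a))) integrable_on cbox 0 1" for x
      by (intro integrable_continuous continuous_intros continuous_on_compose2[OF H]) auto
  qed (use contF in auto)
  have int: "F x integrable_on cbox 0 1" for x
  proof (rule integrable_continuous)
    show "continuous_on (cbox 0 1) (F x)"
      using continuous_on_compose2[OF contF, of "cbox 0 1" "Pair x"]
      by (simp add: continuous_on_Pair image_subset_iff del: cbox_interval)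
  qed
  show ?case
  proof (rule Ck_on_SucI)
    show "((\<lambda>x. integral {0..1} (\<lambda>t. t ^ j * H (a + t *\<^sub>R (x - a)))) has_derivative
        blinfun_apply (integral (cbox 0 1) (F x))) (at x)" for x
      using deriv by simp
    have "Ck_on k UNIV (\<lambda>x. integral {0..1} (\<lambda>t. t ^ Suc j * ?DH (a + t *\<^sub>R (x - a)) v))" for v
      by (rule Suc.IH) (use Suc.prems in simp)
    then show "Ck_on k UNIV (\<lambda>x. blinfun_apply (integral (cbox 0 1) (F x)) v)" for v
      by (simp only: blinfun_apply_integral[OF int[unfolded cbox_interval]] F cbox_interval)
  qed simp
qed

text \<open>Integrate the derivative of \<open>f\<close> along the segment from \<open>a\<close> to
  \<open>x\<close> and expand the direction \<open>x - a\<close> in the basis; the coefficients are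
  averages of partial derivatives.\<close>

lemma Hadamard:
  fixes f :: "'a::euclidean_space \<Rightarrow> real"
  assumes "smooth_on UNIV f"
  obtains G where "\<And>i. smooth_on UNIV (G i)" "\<And>i. G i a = frechet_derivative f (at a) i"
    "\<And>x. f x = f a + (\<Sum>i\<in>Basis. ((x - a) \<bullet> i) * G i x)"
proof
  \<comment> \<open>The factor \<open>t ^ 0\<close> gives the integrand the shape of
    \<open>Ck_on_integral_segment\<close>.\<close>
  define G where "G = (\<lambda>i x. integral {0..1}
    (\<lambda>t. t ^ 0 * frechet_derivative f (at (a + t *\<^sub>R (x - a))) i))"
  let ?Df = "\<lambda>x. frechet_derivative f (at x)"
  have Df: "(f has_derivative ?Df x) (at x)" for x
    using smooth_on_has_derivative[OF assms] by simp
  show "smooth_on UNIV (G i)" for i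
    unfolding G_def smooth_on_def
    by (intro allI Ck_on_integral_segment smooth_on_Ck smooth_on_frechet_derivative assms)
  show "G i a = ?Df a i" for i
    by (simp add: G_def)
  show "f x = f a + (\<Sum>i\<in>Basis. ((x - a) \<bullet> i) * G i x)" for x
  proof -
    let ?p = "\<lambda>t. a + t *\<^sub>R (x - a)"
    have c: "continuous_on UNIV (\<lambda>x. ?Df x i)" for i
      using smooth_on_Ck[OF smooth_on_frechet_derivative[OF assms], of 0] by simp
    have int: "(\<lambda>t. ?Df (?p t) i) integrable_on {0..1}" for i
      by (intro integrable_continuous_interval continuous_on_compose2[OF c] continuous_intros) auto
    have "((\<lambda>t. ?Df (?p t) (x - a)) has_integral f (?p 1) - f (?p 0)) {0..1}"
    proof (rule fundamental_theorem_of_calculus)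
      fix t :: real
      have "(?p has_derivative (\<lambda>s. s *\<^sub>R (x - a))) (at t)"
        by (auto intro!: derivative_eq_intros)
      from has_derivative_compose[OF this Df]
      have "((\<lambda>t. f (?p t)) has_vector_derivative ?Df (?p t) (x - a)) (at t)"
        using linear_scale[OF has_derivative_linear[OF Df]]
        by (simp add: has_vector_derivative_def)
      then show "((\<lambda>t. f (?p t)) has_vector_derivative ?Df (?p t) (x - a)) (at t within {0..1})"
        by (rule has_vector_derivative_at_within)
    qed simp
    then have "f x - f a = integral {0..1} (\<lambda>t. ?Df (?p t) (x - a))"
      by (simp add: integral_unique)
    also have "(\<lambda>t. ?Df (?p t) (x - a)) = (\<lambda>t. \<Sum>i\<in>Basis. ((x - a) \<bullet> i) * ?Df (?p t) i)"
    proof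
      fix t
      interpret linear "?Df (?p t)" using Df has_derivative_linear by blast
      show "?Df (?p t) (x - a) = (\<Sum>i\<in>Basis. ((x - a) \<bullet> i) * ?Df (?p t) i)"
        by (subst (2) euclidean_representation[of "x - a", symmetric])
          (simp only: sum scaleR real_scaleR_def)
    qed
    also have "integral {0..1} \<dots> = (\<Sum>i\<in>Basis. ((x - a) \<bullet> i) * G i x)"
      by (subst integral_sum) (auto simp: G_def intro!: integrable_on_mult_right int)
    finally show ?thesis by simp
  qed
qed

subsection \<open>Extension of tangent vectors to vector fields\<close>

definition zero_extension :: "'m set \<Rightarrow> ('m \<Rightarrow> 'e) \<Rightarrow> ('e \<Rightarrow> real) \<Rightarrow> 'm \<Rightarrow> real"
  where "zero_extension U c w = (\<lambda>q. if q \<in> U then w (c q) else 0)"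

lemma sum_fun_apply: "(\<Sum>i\<in>I. h i) x = (\<Sum>i\<in>I. h i x)"
  by (induction I rule: infinite_finite_induct) (auto simp: plus_fun_def zero_fun_def)

lemma smooth_functionsD:
  "f \<in> smooth_functions A \<Longrightarrow> (U, c) \<in> A \<Longrightarrow> smooth_on (c ` U) (f \<circ> inv_into U c)"
  by (auto simp: smooth_functions_def)

section \<open>Charts and extension of functions by zero\<close>

locale smooth_manifold =
  fixes A :: "('m::t2_space, 'e::euclidean_space) atlas"
  assumes atlas: "smooth_atlas A"
begin

lemma chart:
  assumes "(U, c) \<in> A"
  shows "open U" "open (c ` U)" "homeomorphism U (c ` U) c (inv_into U c)"
  using atlas assms unfolding smooth_atlas_def by blast+

lemma chart_inv:
  assumes "(U, c) \<in> A"
  shows "q \<in> U \<Longrightarrow> inv_into U c (c q) = q"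
    and "y \<in> c ` U \<Longrightarrow> c (inv_into U c y) = y"
    and "y \<in> c ` U \<Longrightarrow> inv_into U c y \<in> U"
  using chart(3)[OF assms] by (auto simp: homeomorphism_def)

lemma chart_at: obtains U c where "(U, c) \<in> A" "p \<in> U"
  using atlas unfolding smooth_atlas_def by blast

lemma transition_smooth:
  "(U, c) \<in> A \<Longrightarrow> (V, d) \<in> A \<Longrightarrow> smooth_on (c ` (U \<inter> V)) (d \<circ> inv_into U c)"
  using atlas unfolding smooth_atlas_def by blast

lemma open_chart_image:
  assumes "(U, c) \<in> A" "open T"
  shows "open (c ` (U \<inter> T))"
proof -
  have "openin (top_of_set (c ` U)) (c ` (U \<inter> T))"
    using homeomorphism_imp_open_map[OF chart(3)[OF assms(1)]] assms(2)
    by (simp add: openin_open_Int)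
  then show ?thesis
    using chart(2)[OF assms(1)] openin_open_trans by blast
qed

text \<open>The preimage of \<open>K\<close> is compact, hence closed in the Hausdorff space. Any
  other chart domain is therefore covered by two open pieces: the overlap with \<open>U\<close>,
  where the transition map is smooth, and the complement of this preimage, where the extension
  vanishes.\<close>

lemma zero_extension_smooth:
  assumes "(U, c) \<in> A" "compact K" "K \<subseteq> c ` U" "smooth_on (c ` U) w"
    and zero: "\<And>y. y \<in> c ` U - K \<Longrightarrow> w y = 0"
  shows "zero_extension U c w \<in> smooth_functions A"
  unfolding smooth_functions_def
proof (clarify)
  fix W d assume W: "(W, d) \<in> A"
  let ?f = "zero_extension U c w" and ?L = "inv_into U c ` K"
  have "compact ?L"
    using chart(3)[OF assms(1)] assms(2,3)
    by (meson compact_continuous_image continuous_on_subset homeomorphism_def)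
  then have "open (- ?L)"
    using compact_imp_closed by blast
  then have open1: "open (d ` (W \<inter> - ?L))" and open2: "open (d ` (W \<inter> U))"
    using open_chart_image W chart(1)[OF assms(1)] by blast+
  have "smooth_on (d ` (W \<inter> U)) (\<lambda>y. w ((c \<circ> inv_into W d) y))"
  proof (rule smooth_on_compose[OF open2 _ transition_smooth[OF W assms(1)] assms(4)])
    show "(c \<circ> inv_into W d) ` d ` (W \<inter> U) \<subseteq> c ` U"
      using chart_inv(1)[OF W] by auto
  qed
  then have s2: "smooth_on (d ` (W \<inter> U)) (?f \<circ> inv_into W d)"
    by (rule smooth_on_cong[OF open2, rotated])
      (use chart_inv(1)[OF W] in \<open>auto simp: zero_extension_def\<close>)
  have vanish: "?f q = 0" if "q \<notin> ?L" for q
  proof (cases "q \<in> U")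
    case True
    have "c q \<notin> K"
      using that chart_inv(1)[OF assms(1) True] by (metis image_eqI)
    then show ?thesis using zero[of "c q"] True by (auto simp: zero_extension_def)
  qed (simp add: zero_extension_def)
  have "smooth_on (d ` (W \<inter> - ?L)) (?f \<circ> inv_into W d)"
    by (rule smooth_on_cong[OF open1 _ smooth_on_const[OF open1, of 0]])
      (use chart_inv(1)[OF W] vanish in auto)
  from smooth_on_Un[OF open2 open1 s2 this]
  have "smooth_on (d ` (W \<inter> U) \<union> d ` (W \<inter> - ?L)) (?f \<circ> inv_into W d)" .
  moreover have "d ` (W \<inter> U) \<union> d ` (W \<inter> - ?L) = d ` W"
  proof -
    have "?L \<subseteq> U" using assms(3) chart_inv(3)[OF assms(1)] by blast
    then show ?thesis by blast
  qed
  ultimately show "smooth_on (d ` W) (?f \<circ> inv_into W d)" by simp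
qed

section \<open>The algebra of smooth functions and its derivations\<close>

lemma smooth_functions_add:
  assumes "f \<in> smooth_functions A" "g \<in> smooth_functions A"
  shows "f + g \<in> smooth_functions A"
  unfolding smooth_functions_def
proof clarify
  fix U c assume U: "(U, c) \<in> A"
  show "smooth_on (c ` U) ((f + g) \<circ> inv_into U c)"
    using smooth_on_add[OF chart(2)[OF U] smooth_functionsD[OF assms(1) U]
        smooth_functionsD[OF assms(2) U]] by (simp add: o_def plus_fun_def)
qed

lemma smooth_functions_mult:
  assumes "f \<in> smooth_functions A" "g \<in> smooth_functions A"
  shows "f * g \<in> smooth_functions A"
  unfolding smooth_functions_def
proof clarify
  fix U c assume U: "(U, c) \<in> A"
  show "smooth_on (c ` U) ((f * g) \<circ> inv_into U c)"
    using smooth_on_mult[OF chart(2)[OF U] smooth_functionsD[OF assms(1) U]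
        smooth_functionsD[OF assms(2) U]] by (simp add: o_def times_fun_def)
qed

lemma smooth_functions_const: "(\<lambda>q. r) \<in> smooth_functions A"
  using smooth_on_const chart(2) by (auto simp: smooth_functions_def o_def)

lemma smooth_functions_zero: "0 \<in> smooth_functions A"
  using smooth_functions_const[of 0] by (simp add: zero_fun_def)

lemma smooth_functions_one: "1 \<in> smooth_functions A"
  using smooth_functions_const[of 1] by (simp add: one_fun_def)

lemma smooth_functions_scaleR:
  assumes "f \<in> smooth_functions A"
  shows "r *\<^sub>R f \<in> smooth_functions A"
proof -
  have "r *\<^sub>R f = (\<lambda>q. r) * f"
    by (simp add: scaleR_fun_def times_fun_def)
  then show ?thesis using smooth_functions_mult[OF smooth_functions_const assms] by simp
qed

lemma smooth_functions_sum:
  "(\<And>i. i \<in> I \<Longrightarrow> h i \<in> smooth_functions A) \<Longrightarrow> (\<Sum>i\<in>I. h i) \<in> smooth_functions A"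
  by (induction I rule: infinite_finite_induct)
    (simp_all add: smooth_functions_zero smooth_functions_add)

lemma tangentD:
  assumes "v \<in> tangent_space A p"
  shows "f \<notin> smooth_functions A \<Longrightarrow> v f = 0"
    and "f \<in> smooth_functions A \<Longrightarrow> g \<in> smooth_functions A \<Longrightarrow> v (f + g) = v f + v g"
    and "f \<in> smooth_functions A \<Longrightarrow> v (r *\<^sub>R f) = r * v f"
    and "f \<in> smooth_functions A \<Longrightarrow> g \<in> smooth_functions A \<Longrightarrow>
      v (f * g) = v f * g p + f p * v g"
  using assms unfolding tangent_space_def by auto

lemma tangent_zero: "v \<in> tangent_space A p \<Longrightarrow> v 0 = 0"
  using tangentD(3)[of v p 0 0] smooth_functions_zero by simp

lemma tangent_sum:
  assumes "v \<in> tangent_space A p"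
  shows "(\<And>i. i \<in> I \<Longrightarrow> h i \<in> smooth_functions A) \<Longrightarrow> v (\<Sum>i\<in>I. h i) = (\<Sum>i\<in>I. v (h i))"
  by (induction I rule: infinite_finite_induct)
    (simp_all add: tangent_zero[OF assms] tangentD(2)[OF assms] smooth_functions_sum)

lemma chart_bump:
  assumes "(U, c) \<in> A" "p \<in> U"
  obtains b K where "smooth_on UNIV b" "b (c p) = (1::real)" "compact K" "K \<subseteq> c ` U"
    "\<And>y. y \<notin> K \<Longrightarrow> b y = 0"
proof -
  obtain r where "r > 0" "cball (c p) r \<subseteq> c ` U"
    using chart(2)[OF assms(1)] assms(2) open_contains_cball by blast
  then show ?thesis
    using smooth_bump_exists[of r "c p"] that[of _ "cball (c p) r"] compact_cball by metis
qed

text \<open>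
  Hadamard's lemma for the function \<open>f\<close>, cut off by a bump \<open>b\<close>, writes \<open>b\<^sup>3 f\<close> as \<open>b\<^sup>2 f(p)\<close> plus a sum
  of products of a cut-off coordinate, which vanishes at \<open>p\<close>, with a smooth function. The derivatives
  of \<open>b\<close> at \<open>p\<close> need not vanish, but they cancel by comparison with \<open>f = 1\<close>.
\<close>

lemma tangent_vector_coordinates:
  assumes U: "(U, c) \<in> A" "p \<in> U" and v: "v \<in> tangent_space A p"
  obtains u where "\<And>f. f \<in> smooth_functions A \<Longrightarrow>
    v f = frechet_derivative (f \<circ> inv_into U c) (at (c p)) u"
proof -
  obtain b K where b: "smooth_on UNIV b" "b (c p) = (1::real)"
    and K: "compact K" "K \<subseteq> c ` U" and b0: "\<And>y. y \<notin> K \<Longrightarrow> b y = 0"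
    using chart_bump[OF U] by metis
  let ?E = "zero_extension U c"
  have ext: "?E (\<lambda>y. b y * w y) \<in> smooth_functions A" if "smooth_on UNIV w" for w
    by (rule zero_extension_smooth[OF U(1) K smooth_on_subset[OF smooth_on_mult[OF _ b(1) that]]])
      (auto simp: b0)
  define \<beta> where "\<beta> = ?E b"
  define X where "X = (\<lambda>i. ?E (\<lambda>y. b y * ((y - c p) \<bullet> i)))"
  \<comment> \<open>The coordinates of the vector are the values of \<open>v\<close> on the cut-off
    coordinate functions.\<close>
  define u where "u = (\<Sum>i\<in>Basis. v (X i) *\<^sub>R i)"
  have \<beta>: "\<beta> \<in> smooth_functions A" "\<beta> p = 1"
    using ext[OF smooth_on_const[of UNIV 1]] U(2) b(2) by (auto simp: \<beta>_def zero_extension_def)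
  have lin: "smooth_on UNIV (\<lambda>y. (y - c p) \<bullet> i)" for i
    unfolding smooth_on_def
    using Ck_on_bounded_linear[OF open_UNIV bounded_linear_inner_left
        Ck_on_add[OF open_UNIV Ck_on_id[OF open_UNIV] Ck_on_const[OF open_UNIV, of _ "- c p"]]]
    by simp
  have X: "X i \<in> smooth_functions A" "X i p = 0" for i
    using ext[OF lin] by (auto simp: X_def zero_extension_def)
  have key: "v f + f p * v \<beta> = f p * frechet_derivative b (at (c p)) u +
      frechet_derivative (f \<circ> inv_into U c) (at (c p)) u"
    if f: "f \<in> smooth_functions A" for f
  proof -
    \<comment> \<open>Hadamard's lemma needs a function on the whole Euclidean space, so the product
      of \<open>b\<close> with the local expression of \<open>f\<close> is extended by zero.\<close>
    define F where "F = (\<lambda>y. if y \<in> c ` U then b y * (f \<circ> inv_into U c) y else 0)"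
    have Fb: "smooth_on (c ` U) (\<lambda>y. b y * (f \<circ> inv_into U c) y)"
      by (intro smooth_on_mult chart(2)[OF U(1)] smooth_functionsD[OF f U(1)]
          smooth_on_subset[OF b(1)]) simp
    have "smooth_on (c ` U) F"
      by (rule smooth_on_cong[OF chart(2)[OF U(1)] _ Fb]) (simp add: F_def)
    moreover have oK: "open (- K)" using K(1) compact_imp_closed by blast
    moreover have "smooth_on (- K) F"
      by (rule smooth_on_cong[OF oK _ smooth_on_const[OF oK, of 0]]) (auto simp: F_def b0)
    moreover have "c ` U \<union> - K = UNIV" using K(2) by blast
    ultimately have F: "smooth_on UNIV F"
      using smooth_on_Un[OF chart(2)[OF U(1)]] by metis
    obtain G where G: "\<And>i. smooth_on UNIV (G i)"
      "\<And>i. G i (c p) = frechet_derivative F (at (c p)) i"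
      "\<And>y. F y = F (c p) + (\<Sum>i\<in>Basis. ((y - c p) \<bullet> i) * G i y)"
      using Hadamard[OF F] by metis
    define H where "H = (\<lambda>i. ?E (\<lambda>y. b y * G i y))"
    have H: "H i \<in> smooth_functions A" "H i p = frechet_derivative F (at (c p)) i" for i
      using ext[OF G(1)] U(2) b(2) G(2) by (auto simp: H_def zero_extension_def)
    have Fp: "F (c p) = f p"
      using U b(2) chart_inv(1)[OF U] by (simp add: F_def)
    have "\<beta> * (\<beta> * (\<beta> * f)) = f p *\<^sub>R (\<beta> * \<beta>) + (\<Sum>i\<in>Basis. X i * H i)"
    proof
      fix q
      show "(\<beta> * (\<beta> * (\<beta> * f))) q = (f p *\<^sub>R (\<beta> * \<beta>) + (\<Sum>i\<in>Basis. X i * H i)) q"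
      proof (cases "q \<in> U")
        case True
        have "b (c q) * f q = f p + (\<Sum>i\<in>Basis. ((c q - c p) \<bullet> i) * G i (c q))"
          using G(3)[of "c q"] True chart_inv(1)[OF U(1) True] by (simp add: Fp) (simp add: F_def)
        then have "b (c q) * (b (c q) * (b (c q) * f q)) =
            b (c q) * (b (c q) * (f p + (\<Sum>i\<in>Basis. ((c q - c p) \<bullet> i) * G i (c q))))"
          by simp
        then show ?thesis
          using True by (simp add: times_fun_def plus_fun_def scaleR_fun_def sum_fun_apply \<beta>_def
              X_def H_def zero_extension_def distrib_left sum_distrib_left mult_ac)
      qed (simp add: times_fun_def plus_fun_def scaleR_fun_def sum_fun_apply \<beta>_def
              X_def H_def zero_extension_def)
    qed
    then have "v (\<beta> * (\<beta> * (\<beta> * f))) = v (f p *\<^sub>R (\<beta> * \<beta>) + (\<Sum>i\<in>Basis. X i * H i))"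
      by simp
    moreover have "v (\<beta> * (\<beta> * (\<beta> * f))) = v f + 3 * f p * v \<beta>"
      using \<beta> f by (simp add: tangentD(4)[OF v] smooth_functions_mult)
    moreover have "v (f p *\<^sub>R (\<beta> * \<beta>) + (\<Sum>i\<in>Basis. X i * H i)) =
        2 * f p * v \<beta> + (\<Sum>i\<in>Basis. v (X i) * H i p)"
      using \<beta> X H by (simp add: tangentD(2,3,4)[OF v] tangent_sum[OF v] smooth_functions_mult
          smooth_functions_sum smooth_functions_scaleR)
    ultimately have "v f + f p * v \<beta> = (\<Sum>i\<in>Basis. v (X i) * H i p)"
      by simp
    also have "\<dots> = frechet_derivative F (at (c p)) u"
    proof -
      interpret linear "frechet_derivative F (at (c p))"
        using smooth_on_has_derivative[OF F] has_derivative_linear by blast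
      show ?thesis by (simp add: u_def H sum scaleR)
    qed
    also have "\<dots> = f p * frechet_derivative b (at (c p)) u +
      frechet_derivative (f \<circ> inv_into U c) (at (c p)) u"
    proof -
      have "((\<lambda>y. b y * (f \<circ> inv_into U c) y) has_derivative
          (\<lambda>w. b (c p) * frechet_derivative (f \<circ> inv_into U c) (at (c p)) w +
            frechet_derivative b (at (c p)) w * (f \<circ> inv_into U c) (c p))) (at (c p))"
        using U by (intro has_derivative_mult smooth_on_has_derivative[OF b(1)]
            smooth_on_has_derivative[OF smooth_functionsD[OF f U(1)]]) auto
      then have "(F has_derivative
          (\<lambda>w. b (c p) * frechet_derivative (f \<circ> inv_into U c) (at (c p)) w +
            frechet_derivative b (at (c p)) w * (f \<circ> inv_into U c) (c p))) (at (c p))"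
        by (rule has_derivative_transform_within_open[OF _ chart(2)[OF U(1)]])
          (use U in \<open>auto simp: F_def\<close>)
      from frechet_derivative_at[OF this, symmetric] show ?thesis
        using b(2) chart_inv(1)[OF U] by (simp add: algebra_simps)
    qed
    finally show ?thesis .
  qed
  have "v 1 = 0"
    using tangentD(4)[OF v smooth_functions_one smooth_functions_one] by simp
  moreover have "frechet_derivative (1 \<circ> inv_into U c) (at (c p)) u = 0"
    by (simp add: o_def one_fun_def)
  ultimately have "v \<beta> = frechet_derivative b (at (c p)) u"
    using key[OF smooth_functions_one] by simp
  then show ?thesis
    using that[of u] key by simp
qed

text \<open>In a chart, take the constant field with the coordinates of \<open>v\<close>, multiply
  it by a bump function equal to 1 at \<open>p\<close>, and extend by zero.\<close>

lemma tangent_vector_extends: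
  assumes v: "v \<in> tangent_space A p"
  obtains Y where "Y \<in> vector_fields A" "Y p = v"
proof -
  obtain U c where U: "(U, c) \<in> A" "p \<in> U" using chart_at .
  obtain u where u: "\<And>f. f \<in> smooth_functions A \<Longrightarrow>
      v f = frechet_derivative (f \<circ> inv_into U c) (at (c p)) u"
    using tangent_vector_coordinates[OF U v] by blast
  obtain b K where b: "smooth_on UNIV b" "b (c p) = (1::real)"
    and K: "compact K" "K \<subseteq> c ` U" and b0: "\<And>y. y \<notin> K \<Longrightarrow> b y = 0"
    using chart_bump[OF U] by metis
  let ?D = "\<lambda>f y. frechet_derivative (f \<circ> inv_into U c) (at y) u"
  \<comment> \<open>The value 0 off the smooth functions is the convention built into
    \<open>tangent_space\<close>.\<close>
  define Y where "Y = (\<lambda>q f. if f \<in> smooth_functions A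
    then zero_extension U c (\<lambda>y. b y * ?D f y) q else 0)"
  have hd: "((f \<circ> inv_into U c) has_derivative
      frechet_derivative (f \<circ> inv_into U c) (at (c q))) (at (c q))"
    if "f \<in> smooth_functions A" "q \<in> U" for f q
    using smooth_on_has_derivative[OF smooth_functionsD[OF that(1) U(1)]] that(2) by blast
  have D_add: "?D (f + g) (c q) = ?D f (c q) + ?D g (c q)"
    and D_scale: "?D (r *\<^sub>R f) (c q) = r * ?D f (c q)"
    and D_mult: "?D (f * g) (c q) = ?D f (c q) * g q + f q * ?D g (c q)"
    if f: "f \<in> smooth_functions A" "g \<in> smooth_functions A" and q: "q \<in> U" for f g q r
  proof -
    note d = hd[OF f(1) q] hd[OF f(2) q]
    show "?D (f + g) (c q) = ?D f (c q) + ?D g (c q)"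
      using frechet_derivative_at[OF has_derivative_add[OF d], symmetric]
      by (simp add: o_def plus_fun_def)
    show "?D (r *\<^sub>R f) (c q) = r * ?D f (c q)"
      using frechet_derivative_at[OF has_derivative_mult_right[OF d(1), of r], symmetric]
      by (simp add: o_def scaleR_fun_def)
    show "?D (f * g) (c q) = ?D f (c q) * g q + f q * ?D g (c q)"
      using frechet_derivative_at[OF has_derivative_mult[OF d], symmetric]
        chart_inv(1)[OF U(1) q]
      by (simp add: o_def times_fun_def)
  qed
  have "Y q \<in> tangent_space A q" for q
    by (auto simp: tangent_space_def Y_def zero_extension_def smooth_functions_add
        smooth_functions_mult smooth_functions_scaleR D_add D_scale D_mult algebra_simps)
  moreover have "dir_deriv Y f \<in> smooth_functions A" if f: "f \<in> smooth_functions A" for f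
  proof -
    have "dir_deriv Y f = zero_extension U c (\<lambda>y. b y * ?D f y)"
      using f by (simp add: dir_deriv_def Y_def)
    moreover have "smooth_on (c ` U) (\<lambda>y. b y * ?D f y)"
      by (intro smooth_on_mult chart(2)[OF U(1)] smooth_on_subset[OF b(1)]
          smooth_on_frechet_derivative smooth_functionsD[OF f U(1)]) simp
    ultimately show ?thesis
      using zero_extension_smooth[OF U(1) K, of "\<lambda>y. b y * ?D f y"] b0 by simp
  qed
  ultimately have "Y \<in> vector_fields A"
    by (simp add: vector_fields_def)
  moreover have "Y p = v"
    using u tangentD(1)[OF v] U(2) b(2) by (auto simp: Y_def zero_extension_def fun_eq_iff)
  ultimately show ?thesis by (rule that)
qed

end

subsection \<open>Operators on vector fields\<close>

text \<open>Functions and vector fields do not form a field, so factors 2 are cancelled in the form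
  \<open>a + a\<close>.\<close>

lemma add_self_eq_0_iff: "(a::'a::real_vector) + a = 0 \<longleftrightarrow> a = 0"
  by (simp add: scaleR_2[symmetric])

lemma double_eq_0_iff: "2 * (a::'a::{real_vector, semiring_numeral}) = 0 \<longleftrightarrow> a = 0"
  by (simp only: mult_2 add_self_eq_0_iff)

lemma half_add_half: "(1/2) *\<^sub>R a + (1/2) *\<^sub>R a = (a::'a::real_vector)"
  by (simp add: scaleR_add_left[symmetric])

lemma fscale_zero: "fscale f 0 = 0" "fscale 0 X = 0"
  by (auto simp: fscale_def)

context smooth_manifold
begin

lemma tangent_add: "v \<in> tangent_space A p \<Longrightarrow> w \<in> tangent_space A p \<Longrightarrow> v + w \<in> tangent_space A p"
  and tangent_scaleR: "v \<in> tangent_space A p \<Longrightarrow> r *\<^sub>R v \<in> tangent_space A p"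
  unfolding tangent_space_def
  by (auto simp: plus_fun_def scaleR_fun_def algebra_simps)

lemma tangent_diff:
  assumes "v \<in> tangent_space A p" "w \<in> tangent_space A p"
  shows "v - w \<in> tangent_space A p"
  using tangent_add[OF assms(1) tangent_scaleR[OF assms(2), of "-1"]] by simp

lemma linear_on_tangentD:
  assumes "linear_on_tangent A p L" "v \<in> tangent_space A p"
  shows "w \<in> tangent_space A p \<Longrightarrow> L (v + w) = L v + L w"
    and "w \<in> tangent_space A p \<Longrightarrow> L (v - w) = L v - L w"
    and "L (r *\<^sub>R v) = r *\<^sub>R L v"
    and "L 0 = 0"
proof -
  show *: "L (v + w) = L v + L w" if "w \<in> tangent_space A p" for w
    using assms that unfolding linear_on_tangent_def by blast
  show **: "L (r *\<^sub>R v) = r *\<^sub>R L v" for r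
    using assms unfolding linear_on_tangent_def by blast
  show "L (v - w) = L v - L w" if "w \<in> tangent_space A p"
    using assms(1) *[OF tangent_scaleR[OF that, of "-1"]] that
    unfolding linear_on_tangent_def by (metis scaleR_minus1_left diff_conv_add_uminus)
  show "L 0 = 0"
    using **[of 0] by simp
qed

lemma vector_fieldD: "X \<in> vector_fields A \<Longrightarrow> X p \<in> tangent_space A p"
  and dir_deriv_smooth: "X \<in> vector_fields A \<Longrightarrow> f \<in> smooth_functions A \<Longrightarrow>
    dir_deriv X f \<in> smooth_functions A"
  by (auto simp: vector_fields_def)

lemma smooth_functions_diff:
  "f \<in> smooth_functions A \<Longrightarrow> g \<in> smooth_functions A \<Longrightarrow> f - g \<in> smooth_functions A"
  using smooth_functions_add[of f "(-1) *\<^sub>R g"] smooth_functions_scaleR[of g "-1"] by simp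

lemma vector_fields_add:
  assumes "X \<in> vector_fields A" "Y \<in> vector_fields A"
  shows "X + Y \<in> vector_fields A"
proof -
  have "dir_deriv (X + Y) f = dir_deriv X f + dir_deriv Y f" for f
    by (simp add: dir_deriv_def plus_fun_def)
  then show ?thesis
    using assms tangent_add smooth_functions_add by (auto simp: vector_fields_def plus_fun_def)
qed

lemma vector_fields_diff:
  assumes "X \<in> vector_fields A" "Y \<in> vector_fields A"
  shows "X - Y \<in> vector_fields A"
proof -
  have "dir_deriv (X - Y) f = dir_deriv X f - dir_deriv Y f" for f
    by (auto simp: dir_deriv_def)
  then show ?thesis
    using assms tangent_diff smooth_functions_diff by (auto simp: vector_fields_def)
qed

lemma dir_deriv_add:
  assumes "X \<in> vector_fields A" "f \<in> smooth_functions A" "g \<in> smooth_functions A"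
  shows "dir_deriv X (f + g) = dir_deriv X f + dir_deriv X g"
  using tangentD(2)[OF vector_fieldD[OF assms(1)] assms(2,3)]
  by (simp add: dir_deriv_def plus_fun_def)

lemma dir_deriv_double:
  "X \<in> vector_fields A \<Longrightarrow> f \<in> smooth_functions A \<Longrightarrow> dir_deriv X (2 * f) = 2 * dir_deriv X f"
  by (simp only: mult_2 dir_deriv_add)

lemma dir_deriv_diff:
  assumes "X \<in> vector_fields A" "f \<in> smooth_functions A" "g \<in> smooth_functions A"
  shows "dir_deriv X (f - g) = dir_deriv X f - dir_deriv X g"
  using dir_deriv_add[OF assms(1), of "f - g" g] assms smooth_functions_diff by simp

lemma dir_deriv_zero: "X \<in> vector_fields A \<Longrightarrow> dir_deriv X 0 = 0"
  using tangent_zero[OF vector_fieldD] by (auto simp: dir_deriv_def)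

lemma dir_deriv_one:
  assumes "X \<in> vector_fields A"
  shows "dir_deriv X 1 = 0"
  using tangentD(4)[OF vector_fieldD[OF assms] smooth_functions_one smooth_functions_one]
  by (auto simp: dir_deriv_def)

lemma dir_deriv_lie_bracket:
  "dir_deriv (lie_bracket X Y) f = dir_deriv X (dir_deriv Y f) - dir_deriv Y (dir_deriv X f)"
  by (auto simp: dir_deriv_def lie_bracket_def)

text \<open>On smooth functions brackets are commutators of derivations. On all others both sides
  vanish because brackets are vector fields; this closure is the hypothesis \<open>b\<close>, to be
  supplied later by a torsion-free connection.\<close>

lemma Jacobi:
  assumes "X \<in> vector_fields A" "Y \<in> vector_fields A" "Z \<in> vector_fields A"
    and b: "\<And>V W. V \<in> vector_fields A \<Longrightarrow> W \<in> vector_fields A \<Longrightarrow> lie_bracket V W \<in> vector_fields A"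
  shows "lie_bracket (lie_bracket Z X) Y + lie_bracket X (lie_bracket Z Y) =
    lie_bracket Z (lie_bracket X Y)"
proof (intro ext)
  fix p f
  show "(lie_bracket (lie_bracket Z X) Y + lie_bracket X (lie_bracket Z Y)) p f =
    lie_bracket Z (lie_bracket X Y) p f"
  proof (cases "f \<in> smooth_functions A")
    case True
    then have "dir_deriv (lie_bracket (lie_bracket Z X) Y) f +
        dir_deriv (lie_bracket X (lie_bracket Z Y)) f =
      dir_deriv (lie_bracket Z (lie_bracket X Y)) f"
      using assms(1-3)
      by (simp add: dir_deriv_lie_bracket dir_deriv_diff dir_deriv_smooth algebra_simps)
    from fun_cong[OF this, of p] show ?thesis
      by (simp add: dir_deriv_def plus_fun_def)
  next
    case False
    note * = tangentD(1)[OF vector_fieldD False]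
    show ?thesis
      using assms(1-3) by (simp add: plus_fun_def * b)
  qed
qed

end

section \<open>Algebra of a paracontact metric structure\<close>

locale paracontact_manifold = smooth_manifold A
  for A :: "('m::t2_space, 'e::euclidean_space) atlas" +
  fixes n :: nat
    and \<phi> :: "'m \<Rightarrow> 'm tvec \<Rightarrow> 'm tvec"
    and \<xi> :: "'m vfield"
    and \<eta> :: "'m \<Rightarrow> 'm tvec \<Rightarrow> real"
    and g :: "'m \<Rightarrow> 'm tvec \<Rightarrow> 'm tvec \<Rightarrow> real"
    and D :: "'m vfield \<Rightarrow> 'm vfield \<Rightarrow> 'm vfield"
  assumes paracontact: "paracontact_metric A n \<phi> \<xi> \<eta> g"
    and levi_civita: "levi_civita A g D"
begin

abbreviation "\<X> \<equiv> vector_fields A"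
abbreviation "G \<equiv> app2 g"
abbreviation "E \<equiv> app1 \<eta>"
abbreviation "P \<equiv> app1 \<phi>"

lemma almost: "almost_paracontact A n \<phi> \<xi> \<eta>"
  and metric: "pseudo_riemannian_metric A g"
  using paracontact by (auto simp: paracontact_metric_def)

lemma phi: "tensor_field_11 A \<phi>"
  and xi [simp]: "\<xi> \<in> \<X>"
  and eta: "one_form A \<eta>"
  using almost by (auto simp: almost_paracontact_def)

lemma g_linear:
  "v \<in> tangent_space A p \<Longrightarrow> linear_on_tangent A p (g p v)"
  "v \<in> tangent_space A p \<Longrightarrow> linear_on_tangent A p (\<lambda>w. g p w v)"
  using metric unfolding pseudo_riemannian_metric_def tensor_field_02_def by auto

lemma phi_linear: "linear_on_tangent A p (\<phi> p)"
  and phi_tangent: "v \<in> tangent_space A p \<Longrightarrow> \<phi> p v \<in> tangent_space A p"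
  using phi unfolding tensor_field_11_def by auto

lemma eta_linear: "linear_on_tangent A p (\<eta> p)"
  using eta unfolding one_form_def by auto

lemma phi_eta:
  "\<phi> p (\<xi> p) = 0" "\<eta> p (\<xi> p) = 1"
  "v \<in> tangent_space A p \<Longrightarrow> \<eta> p (\<phi> p v) = 0"
  "v \<in> tangent_space A p \<Longrightarrow> \<phi> p (\<phi> p v) = v - \<eta> p v *\<^sub>R \<xi> p"
  using almost unfolding almost_paracontact_def by auto

lemma g_phi_phi:
  "v \<in> tangent_space A p \<Longrightarrow> w \<in> tangent_space A p \<Longrightarrow>
    g p (\<phi> p v) (\<phi> p w) = - g p v w + \<eta> p v * \<eta> p w"
  using paracontact unfolding paracontact_metric_def by blast

text \<open>Compatibility with second argument \<open>\<xi> p\<close>, where \<open>\<phi>\<close>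
  vanishes.\<close>

lemma g_xi:
  assumes v: "v \<in> tangent_space A p"
  shows "g p v (\<xi> p) = \<eta> p v"
  using g_phi_phi[OF v vector_fieldD[OF xi]] linear_on_tangentD(4)[OF g_linear(1) v, of "\<phi> p v"]
    phi_tangent[OF v] by (simp add: phi_eta)

text \<open>Replace \<open>w\<close> by \<open>\<phi> p w\<close> in the compatibility condition.
  The \<open>\<xi>\<close> part of \<open>\<phi> p (\<phi> p w)\<close> does not contribute, since
  \<open>\<phi> p v\<close> is orthogonal to \<open>\<xi> p\<close>.\<close>

lemma g_phi_skew:
  assumes v: "v \<in> tangent_space A p" and w: "w \<in> tangent_space A p"
  shows "g p (\<phi> p v) w = - g p v (\<phi> p w)"
proof -
  note lin = linear_on_tangentD[OF g_linear(1)[OF phi_tangent[OF v]]]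
  have "g p (\<phi> p v) (\<phi> p (\<phi> p w)) = g p (\<phi> p v) w - \<eta> p w * g p (\<phi> p v) (\<xi> p)"
    using w vector_fieldD[OF xi]
    by (simp add: phi_eta lin(2,3) tangent_scaleR)
  then show ?thesis
    using g_phi_phi[OF v phi_tangent[OF w]] phi_eta(3)[OF v] phi_eta(3)[OF w]
      g_xi[OF phi_tangent[OF v]] by simp
qed

lemma \<X>_closed [simp]:
  "X \<in> \<X> \<Longrightarrow> Y \<in> \<X> \<Longrightarrow> X + Y \<in> \<X>"
  "X \<in> \<X> \<Longrightarrow> Y \<in> \<X> \<Longrightarrow> X - Y \<in> \<X>"
  "X \<in> \<X> \<Longrightarrow> P X \<in> \<X>"
  "X \<in> \<X> \<Longrightarrow> Y \<in> \<X> \<Longrightarrow> D X Y \<in> \<X>"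
  using vector_fields_add vector_fields_diff phi levi_civita
  unfolding tensor_field_11_def levi_civita_def affine_connection_def by auto

lemma zero_\<X> [simp]: "0 \<in> \<X>"
  using \<X>_closed(2)[OF xi xi] by simp

lemma uminus_\<X> [simp]: "X \<in> \<X> \<Longrightarrow> - X \<in> \<X>"
  using \<X>_closed(2)[OF zero_\<X>] by simp

lemma smooth [simp]:
  "X \<in> \<X> \<Longrightarrow> E X \<in> smooth_functions A"
  "X \<in> \<X> \<Longrightarrow> Y \<in> \<X> \<Longrightarrow> G X Y \<in> smooth_functions A"
  using eta metric
  unfolding one_form_def pseudo_riemannian_metric_def tensor_field_02_def by auto

lemma P_simps [simp]:
  "X \<in> \<X> \<Longrightarrow> Y \<in> \<X> \<Longrightarrow> P (X + Y) = P X + P Y"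
  "X \<in> \<X> \<Longrightarrow> Y \<in> \<X> \<Longrightarrow> P (X - Y) = P X - P Y"
  "P 0 = 0" "P \<xi> = 0"
  using linear_on_tangentD[OF phi_linear vector_fieldD] linear_on_tangentD(4)[OF phi_linear vector_fieldD[OF xi]]
  by (auto simp: app1_def fun_eq_iff plus_fun_def phi_eta vector_fieldD)

lemma P_uminus [simp]: "X \<in> \<X> \<Longrightarrow> P (- X) = - P X"
  using P_simps(2)[of 0 X] by simp

lemma P_P: "X \<in> \<X> \<Longrightarrow> P (P X) = X - fscale (E X) \<xi>"
  by (auto simp: app1_def fscale_def phi_eta vector_fieldD)

lemma E_simps [simp]:
  "X \<in> \<X> \<Longrightarrow> Y \<in> \<X> \<Longrightarrow> E (X + Y) = E X + E Y"
  "X \<in> \<X> \<Longrightarrow> Y \<in> \<X> \<Longrightarrow> E (X - Y) = E X - E Y"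
  "E \<xi> = 1"
  "X \<in> \<X> \<Longrightarrow> E (P X) = 0"
  using linear_on_tangentD[OF eta_linear vector_fieldD]
  by (auto simp: app1_def fun_eq_iff plus_fun_def phi_eta vector_fieldD)

lemma G_simps [simp]:
  "X \<in> \<X> \<Longrightarrow> Y \<in> \<X> \<Longrightarrow> Z \<in> \<X> \<Longrightarrow> G (X + Y) Z = G X Z + G Y Z"
  "X \<in> \<X> \<Longrightarrow> Y \<in> \<X> \<Longrightarrow> Z \<in> \<X> \<Longrightarrow> G (X - Y) Z = G X Z - G Y Z"
  "X \<in> \<X> \<Longrightarrow> Y \<in> \<X> \<Longrightarrow> Z \<in> \<X> \<Longrightarrow> G Z (X + Y) = G Z X + G Z Y"
  "X \<in> \<X> \<Longrightarrow> Y \<in> \<X> \<Longrightarrow> Z \<in> \<X> \<Longrightarrow> G Z (X - Y) = G Z X - G Z Y"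
  "Z \<in> \<X> \<Longrightarrow> G 0 Z = 0"
  "Z \<in> \<X> \<Longrightarrow> G Z 0 = 0"
  "X \<in> \<X> \<Longrightarrow> G X \<xi> = E X"
  "X \<in> \<X> \<Longrightarrow> G \<xi> X = E X"
  using linear_on_tangentD[OF g_linear(1)[OF vector_fieldD] vector_fieldD]
    linear_on_tangentD[OF g_linear(2)[OF vector_fieldD] vector_fieldD] metric
  by (auto simp: app1_def app2_def fun_eq_iff plus_fun_def g_xi vector_fieldD
      pseudo_riemannian_metric_def)

lemma G_P: "X \<in> \<X> \<Longrightarrow> Y \<in> \<X> \<Longrightarrow> G (P X) Y = - G X (P Y)"
  by (auto simp: app1_def app2_def g_phi_skew vector_fieldD)

lemma G_sym: "X \<in> \<X> \<Longrightarrow> Y \<in> \<X> \<Longrightarrow> G X Y = G Y X"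
  using metric by (auto simp: app2_def pseudo_riemannian_metric_def vector_fieldD)

text \<open>Every tangent vector extends to a global field, so testing against fields amounts to
  testing on each tangent space.\<close>

lemma G_nondegenerate:
  assumes "X \<in> \<X>" "\<And>Y. Y \<in> \<X> \<Longrightarrow> G X Y = 0"
  shows "X = 0"
proof
  fix p
  have "g p (X p) w = 0" if w: "w \<in> tangent_space A p" for w
  proof -
    obtain Y where "Y \<in> \<X>" "Y p = w"
      using tangent_vector_extends[OF w] .
    then show ?thesis using fun_cong[OF assms(2), of Y p] by (simp add: app2_def)
  qed
  moreover have "\<forall>v\<in>tangent_space A p. (\<forall>w\<in>tangent_space A p. g p v w = 0) \<longrightarrow> v = 0"
    using metric unfolding pseudo_riemannian_metric_def by blast
  ultimately show "X p = 0 p"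
    using vector_fieldD[OF assms(1), of p] by simp
qed

section \<open>Rules for the Levi-Civita connection\<close>

lemma D_simps [simp]:
  "X \<in> \<X> \<Longrightarrow> Y \<in> \<X> \<Longrightarrow> Z \<in> \<X> \<Longrightarrow> D (X + Y) Z = D X Z + D Y Z"
  "X \<in> \<X> \<Longrightarrow> Y \<in> \<X> \<Longrightarrow> Z \<in> \<X> \<Longrightarrow> D X (Y + Z) = D X Y + D X Z"
  using levi_civita unfolding levi_civita_def affine_connection_def by blast+

lemma D_diff [simp]:
  "X \<in> \<X> \<Longrightarrow> Y \<in> \<X> \<Longrightarrow> Z \<in> \<X> \<Longrightarrow> D (X - Y) Z = D X Z - D Y Z"
  "X \<in> \<X> \<Longrightarrow> Y \<in> \<X> \<Longrightarrow> Z \<in> \<X> \<Longrightarrow> D X (Y - Z) = D X Y - D X Z"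
  using D_simps(1)[of "X - Y" Y Z] D_simps(2)[of X "Y - Z" Z] by auto

lemma D_zero [simp]: "X \<in> \<X> \<Longrightarrow> D X 0 = 0" "X \<in> \<X> \<Longrightarrow> D 0 X = 0"
  using D_diff(1)[of \<xi> \<xi> X] D_diff(2)[of X \<xi> \<xi>] by auto

lemma D_uminus [simp]:
  "X \<in> \<X> \<Longrightarrow> Y \<in> \<X> \<Longrightarrow> D X (- Y) = - D X Y"
  "X \<in> \<X> \<Longrightarrow> Y \<in> \<X> \<Longrightarrow> D (- X) Y = - D X Y"
  using D_diff(2)[of X 0 Y] D_diff(1)[of 0 X Y] by auto

lemma D_fscale:
  assumes "f \<in> smooth_functions A" "X \<in> \<X>" "Y \<in> \<X>"
  shows "D (fscale f X) Y = fscale f (D X Y)"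
    and "D X (fscale f Y) = fscale (dir_deriv X f) Y + fscale f (D X Y)"
  using levi_civita assms unfolding levi_civita_def affine_connection_def by blast+

lemma torsion_free: "X \<in> \<X> \<Longrightarrow> Y \<in> \<X> \<Longrightarrow> lie_bracket X Y = D X Y - D Y X"
  using levi_civita unfolding levi_civita_def by simp

text \<open>Closure is read off from the torsion-free connection rather than from the derivation
  property.\<close>

lemma lie_bracket_\<X> [simp]: "X \<in> \<X> \<Longrightarrow> Y \<in> \<X> \<Longrightarrow> lie_bracket X Y \<in> \<X>"
  by (simp add: torsion_free)

lemma D_metric: "X \<in> \<X> \<Longrightarrow> Y \<in> \<X> \<Longrightarrow> Z \<in> \<X> \<Longrightarrow>
    dir_deriv X (G Y Z) = G (D X Y) Z + G Y (D X Z)"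
  using levi_civita unfolding levi_civita_def by simp

subsection \<open>The symmetric part of \<open>\<nabla>\<xi>\<close>\<close>

definition S :: "'m vfield \<Rightarrow> 'm vfield"
  where "S X = D X \<xi> + P X"

lemma D_xi: "D X \<xi> = S X - P X"
  by (simp add: S_def)

lemma S_simps [simp]:
  "X \<in> \<X> \<Longrightarrow> S X \<in> \<X>"
  "X \<in> \<X> \<Longrightarrow> Y \<in> \<X> \<Longrightarrow> S (X + Y) = S X + S Y"
  "X \<in> \<X> \<Longrightarrow> Y \<in> \<X> \<Longrightarrow> S (X - Y) = S X - S Y"
  "X \<in> \<X> \<Longrightarrow> S (- X) = - S X"
  "S 0 = 0"
  by (simp_all add: S_def)

lemma dir_deriv_E:
  assumes "X \<in> \<X>" "Y \<in> \<X>"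
  shows "dir_deriv X (E Y) = E (D X Y) + G Y (D X \<xi>)"
  using D_metric[OF assms xi] assms by simp

lemma two_d_eta:
  assumes "X \<in> \<X>" "Y \<in> \<X>"
  shows "G X (P Y) + G X (P Y) =
    dir_deriv X (E Y) - dir_deriv Y (E X) - E (lie_bracket X Y)"
proof -
  have "G X (P Y) = ext_deriv \<eta> X Y"
    using paracontact assms unfolding paracontact_metric_def by blast
  then show ?thesis
    by (simp only: ext_deriv_def half_add_half)
qed

text \<open>Because the torsion vanishes, 2 d\<eta>(X, Y) equals g(Y, \<open>D X \<xi>\<close>) -
  g(X, \<open>D Y \<xi>\<close>), and by the contact condition it is also 2 g(X,
  \<open>P Y\<close>). Thus the skew part of \<open>D X \<xi>\<close> is
  \<open>- P X\<close>.\<close>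

lemma G_D_xi:
  assumes "X \<in> \<X>" "Y \<in> \<X>"
  shows "G (D X \<xi>) Y = G X (D Y \<xi>) + G X (P Y) + G X (P Y)"
  using two_d_eta[OF assms] assms G_sym[of "D X \<xi>" Y]
  by (simp add: dir_deriv_E torsion_free algebra_simps)

text \<open>Differentiating g(\<xi>, \<xi>) = 1 along \<open>X\<close> gives twice the left-hand
  side.\<close>

lemma E_D_xi:
  assumes "X \<in> \<X>"
  shows "E (D X \<xi>) = 0"
  using dir_deriv_E[OF assms xi] assms by (simp add: dir_deriv_one double_eq_0_iff)

text \<open>With \<open>X = \<xi>\<close>, every term on the right of \<open>G_D_xi\<close> is a
  value of \<open>\<eta>\<close> on its kernel.\<close>

lemma D_xi_xi [simp]: "D \<xi> \<xi> = 0"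
  by (rule G_nondegenerate) (simp_all add: G_D_xi E_D_xi)

lemma S_xi [simp]: "S \<xi> = 0"
  by (simp add: S_def)

lemma E_S [simp]: "X \<in> \<X> \<Longrightarrow> E (S X) = 0"
  by (simp add: S_def E_D_xi)

text \<open>Adding \<open>P X\<close> to \<open>D X \<xi>\<close> cancels the skew part found in
  \<open>G_D_xi\<close>.\<close>

lemma S_symmetric:
  assumes "X \<in> \<X>" "Y \<in> \<X>"
  shows "G (S X) Y = G X (S Y)"
  using assms by (simp add: S_def G_D_xi G_P)

lemma S_fscale_xi: "f \<in> smooth_functions A \<Longrightarrow> S (fscale f \<xi>) = 0"
proof -
  have "P (fscale f \<xi>) = 0"
    using linear_on_tangentD(3)[OF phi_linear vector_fieldD[OF xi]]
    by (auto simp: app1_def fscale_def phi_eta)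
  then show "f \<in> smooth_functions A \<Longrightarrow> S (fscale f \<xi>) = 0"
    by (simp add: S_def D_fscale fscale_zero)
qed

section \<open>Derivatives along \<open>\<xi>\<close>: \<open>\<eta>\<close> and
  \<open>\<phi>\<close> are parallel\<close>

lemma dir_deriv_xi_E: "X \<in> \<X> \<Longrightarrow> dir_deriv \<xi> (E X) = E (D \<xi> X)"
  by (simp add: dir_deriv_E)

lemma lie_bracket_xi: "X \<in> \<X> \<Longrightarrow> lie_bracket \<xi> X = D \<xi> X - S X + P X"
  by (simp add: torsion_free D_xi)

text \<open>This says that the Lie derivative of \<open>\<eta>\<close> along \<open>\<xi>\<close> is
  zero: \<open>S\<close> and \<open>P\<close> take values in the kernel of \<open>\<eta>\<close>,
  and \<open>\<eta>\<close> is parallel along \<open>\<xi>\<close>.\<close>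

lemma E_lie_bracket_xi: "X \<in> \<X> \<Longrightarrow> E (lie_bracket \<xi> X) = dir_deriv \<xi> (E X)"
  by (simp add: lie_bracket_xi dir_deriv_xi_E)

text \<open>Since \<open>\<L>\<^sub>\<xi>\<eta> = 0\<close>, also \<open>\<L>\<^sub>\<xi>d\<eta> = 0\<close>.\<close>

lemma lie_deriv_d_eta:
  assumes X: "X \<in> \<X>" and Y: "Y \<in> \<X>"
  shows "dir_deriv \<xi> (G X (P Y)) =
    G (lie_bracket \<xi> X) (P Y) + G X (P (lie_bracket \<xi> Y))" (is "?l = ?r")
proof -
  \<comment> \<open>Doubling both sides allows \<open>two_d_eta\<close> to be used without the
    factor 1/2.\<close>
  have "?l + ?l = dir_deriv \<xi> (G X (P Y) + G X (P Y))"
    using assms by (simp add: dir_deriv_double)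
  also have "\<dots> = dir_deriv \<xi> (dir_deriv X (E Y)) - dir_deriv \<xi> (dir_deriv Y (E X)) -
      E (lie_bracket \<xi> (lie_bracket X Y))"
    using assms by (simp add: two_d_eta dir_deriv_diff dir_deriv_smooth smooth_functions_diff
        E_lie_bracket_xi)
  \<comment> \<open>Commuting \<open>\<xi>\<close> past \<open>X\<close> and \<open>Y\<close>,
    together with the Jacobi identity, regroups the terms into two instances of
    \<open>two_d_eta\<close>.\<close>
  also have "\<dots> = (dir_deriv (lie_bracket \<xi> X) (E Y) - dir_deriv Y (E (lie_bracket \<xi> X)) -
        E (lie_bracket (lie_bracket \<xi> X) Y)) +
      (dir_deriv X (E (lie_bracket \<xi> Y)) - dir_deriv (lie_bracket \<xi> Y) (E X) -
        E (lie_bracket X (lie_bracket \<xi> Y)))"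
    using assms
    by (simp add: E_lie_bracket_xi dir_deriv_lie_bracket Jacobi[OF X Y xi, symmetric] algebra_simps)
  also have "\<dots> = ?r + ?r"
    unfolding two_d_eta[OF lie_bracket_\<X>[OF xi X] Y, symmetric]
      two_d_eta[OF X lie_bracket_\<X>[OF xi Y], symmetric]
    by (simp add: algebra_simps)
  finally have "(?l - ?r) + (?l - ?r) = 0" by (simp add: algebra_simps)
  then show ?thesis by (simp only: add_self_eq_0_iff right_minus_eq)
qed

text \<open>Compare \<open>lie_deriv_d_eta\<close>, with the brackets expanded by
  \<open>lie_bracket_xi\<close>, with the metric property of \<open>D\<close>. The two terms
  quadratic in \<open>P\<close> cancel by skewness, and symmetry moves \<open>S\<close> off
  \<open>X\<close>, which nondegeneracy then removes.\<close>

lemma D_P_eq: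
  assumes Y: "Y \<in> \<X>"
  shows "D \<xi> (P Y) - P (D \<xi> Y) = - (S (P Y) + P (S Y))"
proof -
  have "D \<xi> (P Y) - P (D \<xi> Y) + (S (P Y) + P (S Y)) = 0" (is "?Z = 0")
  proof (rule G_nondegenerate)
    fix X assume X: "X \<in> \<X>"
    have "G X ?Z = 0"
      using lie_deriv_d_eta[OF X Y] D_metric[OF xi X, of "P Y"] X Y
      by (simp add: lie_bracket_xi S_symmetric G_P algebra_simps)
    then show "G ?Z X = 0" using G_sym[of X ?Z] X Y by simp
  qed (use Y in simp)
  then show ?thesis by (simp only: eq_neg_iff_add_eq_0)
qed

text \<open>Along \<open>\<xi>\<close> the square of \<open>P\<close> is parallel, being built from
  the identity and the parallel \<open>\<eta>\<close> and \<open>\<xi>\<close>.\<close>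

lemma D_P_P:
  assumes Y: "Y \<in> \<X>"
  shows "D \<xi> (P (P Y)) = P (P (D \<xi> Y))"
proof -
  have "fscale (E Y) \<xi> = Y - P (P Y)" using P_P[OF Y] by simp
  then have f: "fscale (E Y) \<xi> \<in> \<X>" using Y by simp
  show ?thesis
    using Y f by (simp add: P_P D_fscale dir_deriv_xi_E fscale_zero)
qed

text \<open>Since the square of \<open>P\<close> is parallel along \<open>\<xi>\<close>, the
  derivative of \<open>P\<close> anticommutes with \<open>P\<close>. By \<open>D_P_eq\<close> it is
  minus SP + PS, which commutes with \<open>P\<close>. So the product of the two vanishes.\<close>

lemma S_P:
  assumes Y: "Y \<in> \<X>"
  shows "S (P Y) = - P (S Y)"
proof -
  have fy: "fscale (E Y) \<xi> = Y - P (P Y)" using P_P[OF Y] by simp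
  then have f: "fscale (E Y) \<xi> \<in> \<X>" using Y by simp
  have 1: "S (P (P Y)) = S Y"
    using Y f by (simp add: P_P S_fscale_xi)
  have PP: "P (P Z) = Z" if "Z \<in> \<X>" "E Z = 0" for Z
    using that by (simp add: P_P fscale_zero)
  let ?U = "P (D \<xi> (P Y))" and ?V = "P (P (D \<xi> Y))" and ?W = "S Y + P (S (P Y))"
  have "?U - ?V = - ?W"
    using arg_cong[OF D_P_eq[OF Y], of P] Y by (simp add: PP)
  moreover have "?V - ?U = - ?W"
    using D_P_eq[of "P Y"] Y by (simp add: D_P_P 1)
  moreover have "(?U - ?V) + (?V - ?U) = 0" by simp
  ultimately have "- (?W + ?W) = 0"
    by (simp only: minus_add_distrib)
  then have "?W + ?W = 0"
    by (simp only: neg_equal_0_iff_equal)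
  then have "S Y + P (S (P Y)) = 0"
    by (simp only: add_self_eq_0_iff)
  \<comment> \<open>Both \<open>S Y\<close> and \<open>S (P Y)\<close> lie in the kernel of
    \<open>\<eta>\<close>, where \<open>P\<close> is its own inverse, so another \<open>P\<close>
    recovers the anticommutator.\<close>
  then have "P (S Y + P (S (P Y))) = 0" by simp
  then have "P (S Y) + S (P Y) = 0"
    using Y by (simp add: PP)
  then show ?thesis by (metis add.commute eq_neg_iff_add_eq_0)
qed

lemma D_P: "Y \<in> \<X> \<Longrightarrow> D \<xi> (P Y) = P (D \<xi> Y)"
  using D_P_eq[of Y] by (simp add: S_P)

subsection \<open>The three conditions in terms of \<open>\<nabla>\<^sub>\<xi>S\<close>\<close>

abbreviation "Q \<equiv> cov_deriv_11 D \<xi> S"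

lemma Q_eq: "Q X = D \<xi> (S X) - S (D \<xi> X)"
  by (simp add: cov_deriv_11_def)

lemma Q_\<X> [simp]: "X \<in> \<X> \<Longrightarrow> Q X \<in> \<X>"
  by (simp add: Q_eq)

text \<open>\<open>Q X\<close> lies in the kernel of \<open>\<eta>\<close>, because
  \<open>\<eta>\<close> is parallel along \<open>\<xi>\<close> and vanishes on the values of
  \<open>S\<close>; on that kernel \<open>P\<close> is an involution.\<close>

lemma P_Q_eq_0_iff:
  assumes "X \<in> \<X>"
  shows "P (Q X) = 0 \<longleftrightarrow> Q X = 0"
proof
  assume 0: "P (Q X) = 0"
  have "E (Q X) = 0"
    using assms by (simp add: Q_eq dir_deriv_xi_E[symmetric] dir_deriv_zero)
  then show "Q X = 0"
    using P_P[of "Q X"] 0 assms by (simp add: fscale_zero)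
qed simp

text \<open>In the Lie derivative the covariant derivatives cancel by \<open>D_P\<close>, as do the
  two terms \<open>P (P X)\<close>. What is left is \<open>P (S X) - S (P X)\<close>, and
  \<open>S_P\<close> makes its terms equal.\<close>

lemma h_op_eq:
  assumes "X \<in> \<X>"
  shows "h_op \<phi> \<xi> X = P (S X)"
proof -
  have "lie_deriv_11 \<xi> P X = P (S X) + P (S X)"
    using assms by (simp add: lie_deriv_11_def lie_bracket_xi D_P S_P)
  then show ?thesis by (simp only: h_op_def scaleR_half_double)
qed

lemma cov_deriv_h: "X \<in> \<X> \<Longrightarrow> cov_deriv_11 D \<xi> (h_op \<phi> \<xi>) X = P (Q X)"
  by (simp add: cov_deriv_11_def h_op_eq D_P)

text \<open>The covariant derivatives cancel because the metric is parallel, the terms in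
  \<open>P\<close> because it is skew; the two terms in \<open>S\<close> agree by symmetry.\<close>

lemma tau_eq:
  assumes "X \<in> \<X>" "Y \<in> \<X>"
  shows "tau g \<xi> X Y = G (S X) Y + G (S X) Y"
  using assms by (simp add: tau_def lie_deriv_02_def D_metric lie_bracket_xi S_symmetric G_P)

lemma cov_deriv_tau:
  assumes "X \<in> \<X>" "Y \<in> \<X>"
  shows "cov_deriv_02 D \<xi> (tau g \<xi>) X Y = G (Q X) Y + G (Q X) Y"
  using assms by (simp add: cov_deriv_02_def tau_eq dir_deriv_double D_metric Q_eq algebra_simps)

text \<open>Insert \<open>D_xi\<close> twice into the curvature. The term with
  \<open>D \<xi> \<xi>\<close> vanishes, and the mixed products of \<open>S\<close> and
  \<open>P\<close> cancel by \<open>S_P\<close>.\<close>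

lemma l_op_eq:
  assumes "X \<in> \<X>"
  shows "l_op D \<xi> X = - Q X - S (S X) - P (P X)"
proof -
  have "D X \<xi> - D \<xi> X = lie_bracket X \<xi>" using assms by (simp add: torsion_free)
  then have "l_op D \<xi> X = D X (D \<xi> \<xi>) - D \<xi> (D X \<xi>) - D (D X \<xi> - D \<xi> X) \<xi>"
    by (simp add: l_op_def curvature_def)
  then show ?thesis
    using assms by (simp add: D_xi[of X] D_xi[of "D \<xi> X"] D_xi[of "S X"] D_xi[of "P X"] Q_eq D_P S_P)
qed

text \<open>\<open>Q\<close> inherits from \<open>S\<close> that it anticommutes with
  \<open>P\<close>, whereas the squares of \<open>S\<close> and \<open>P\<close> commute with
  \<open>P\<close>; hence only the terms in \<open>Q\<close> survive, and they add up.\<close>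

lemma l_op_commutator:
  assumes "X \<in> \<X>"
  shows "l_op D \<xi> (P X) - P (l_op D \<xi> X) = P (Q X) + P (Q X)"
  using assms by (simp add: l_op_eq Q_eq D_P S_P)

lemma cov_deriv_h_eq_0_iff:
  "(\<forall>X\<in>\<X>. cov_deriv_11 D \<xi> (h_op \<phi> \<xi>) X = 0) \<longleftrightarrow> (\<forall>X\<in>\<X>. Q X = 0)"
  by (simp add: cov_deriv_h P_Q_eq_0_iff)

lemma cov_deriv_tau_eq_0_iff:
  "(\<forall>X\<in>\<X>. \<forall>Y\<in>\<X>. cov_deriv_02 D \<xi> (tau g \<xi>) X Y = 0) \<longleftrightarrow> (\<forall>X\<in>\<X>. Q X = 0)"
  using G_nondegenerate[OF Q_\<X>] by (auto simp: cov_deriv_tau double_eq_0_iff)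

lemma l_op_commutes_iff:
  "(\<forall>X\<in>\<X>. l_op D \<xi> (P X) = P (l_op D \<xi> X)) \<longleftrightarrow> (\<forall>X\<in>\<X>. Q X = 0)"
proof -
  have "l_op D \<xi> (P X) = P (l_op D \<xi> X) \<longleftrightarrow> Q X = 0" if "X \<in> \<X>" for X
    using add_self_eq_0_iff[of "P (Q X)"]
    by (simp only: l_op_commutator[OF that, symmetric] P_Q_eq_0_iff[OF that] right_minus_eq)
  then show ?thesis by blast
qed

end

theorem proposition3p3:
  fixes A :: "('m::{t2_space, second_countable_topology}, 'e::euclidean_space) atlas"
    and n :: nat
    and \<phi> :: "'m \<Rightarrow> 'm tvec \<Rightarrow> 'm tvec"
    and \<xi> :: "'m vfield"
    and \<eta> :: "'m \<Rightarrow> 'm tvec \<Rightarrow> real"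
    and g :: "'m \<Rightarrow> 'm tvec \<Rightarrow> 'm tvec \<Rightarrow> real"
    and D :: "'m vfield \<Rightarrow> 'm vfield \<Rightarrow> 'm vfield"
  assumes "smooth_atlas A"
    and "DIM('e) = 2 * n + 1"
    and "paracontact_metric A n \<phi> \<xi> \<eta> g"
    and "levi_civita A g D"
  shows "((\<forall>X\<in>vector_fields A. cov_deriv_11 D \<xi> (h_op \<phi> \<xi>) X = 0) \<longleftrightarrow>
          (\<forall>X\<in>vector_fields A. \<forall>Y\<in>vector_fields A. cov_deriv_02 D \<xi> (tau g \<xi>) X Y = 0)) \<and>
         ((\<forall>X\<in>vector_fields A. \<forall>Y\<in>vector_fields A. cov_deriv_02 D \<xi> (tau g \<xi>) X Y = 0) \<longleftrightarrow>
          (\<forall>X\<in>vector_fields A. l_op D \<xi> (app1 \<phi> X) = app1 \<phi> (l_op D \<xi> X)))"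
proof -
  interpret paracontact_manifold A n \<phi> \<xi> \<eta> g D
    using assms by unfold_locales
  show ?thesis
    by (simp only: cov_deriv_h_eq_0_iff cov_deriv_tau_eq_0_iff l_op_commutes_iff simp_thms)
qed

end
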